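(* (1) For every $n\ge 5$, there exist a $\frac{2(n-1)}{3}$-nonnegative algebraic curvature operator $R$ on $\mathbb R^n$ and a trace-free symmetric two-tensor $h$ on $\mathbb R^n$ such that $Q(R,h)<0$. (2) If $3\le n\le 341$, every $\frac{2(n-1)}{3}$-nonnegative algebraic curvature operator $R$ on $\mathbb R^n$ satisfies $Q(R,\operatorname{Ric}_R)\ge 0$. (3) For every $n\ge 342$, there exists a $\frac{2(n-1)}{3}$-nonnegative algebraic curvature operator $R$ on $\mathbb R^n$ such that $Q(R,\operatorname{Ric}_R)<0$.
   Context: Let $V=\mathbb R^n$ with its standard inner product, and let $\bigwedge^2V$ carry $\langle x\wedge y,z\wedge w\rangle=\langle x,z\rangle\langle y,w\rangle-\langle x,w\rangle\langle y,z\rangle$. An algebraic curvature operator is a self-adjoint operator $R$ on $\bigwedge^2V$ such that the $(0,4)$-tensor $R(x,y,z,w)=\langle R(x\wedge y),z\wedge w\rangle$ satisfies the first Bianchi identity $R(x,y,z,w)+R(y,z,x,w)+R(z,x,y,w)=0$. Its Ricci tensor is $\operatorname{Ric}_R(x,y)=\sum_iR(x,e_i,y,e_i)$ for an orthonormal basis $(e_i)$. $\bigwedge^2V$ is identified with the skew-adjoint endomorphisms $\mathfrak{so}(V)$ by $(x\wedge y)z=\langle x,z\rangle y-\langle y,z\rangle x$. For $L\in\mathfrak{so}(V)$ and a symmetric two-tensor $h$, $(L\cdot h)(x,y)=-h(Lx,y)-h(x,Ly)$. With $\eta_1,\dots,\eta_N$, $N=\binom n2$, an orthonormal eigenbasis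 of $R$ with eigenvalues $\lambda_1\le\cdots\le\lambda_N$, put $$Q(R,h)=\sum_{i=1}^N\lambda_i|\eta_i\cdot h|^2,$$ where $|\cdot|$ is the tensor norm (the Hilbert-Schmidt norm of the associated endomorphism of $\mathbb R^n$). For real $1\le k\le N$, $\Sigma_k(R)=\lambda_1+\cdots+\lambda_{\lfloor k\rfloor}+(k-\lfloor k\rfloor)\lambda_{\lfloor k\rfloor+1}$, the last term being omitted when $k$ is an integer; $R$ is $k$-nonnegative if $\Sigma_k(R)\ge 0$. *)

theory Defs
  imports "HOL-Analysis.Analysis"
begin

section \<open>Bivectors as skew-adjoint matrices\<close>

text \<open>
  The exterior square of \<open>V = real ^ 'n\<close> is modelled by its identification with the
  skew-adjoint endomorphisms of \<open>V\<close>, written as matrices. An operator on it is a function on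
  matrices of which only the restriction to \<open>bivectors\<close> matters.
\<close>

definition bivectors :: "(real ^ 'n ^ 'n) set" where
  "bivectors = {A. transpose A = - A}"

definition wedge :: "real ^ 'n \<Rightarrow> real ^ 'n \<Rightarrow> real ^ 'n ^ 'n" where
  "wedge x y = matrix (\<lambda>z. (x \<bullet> z) *\<^sub>R y - (y \<bullet> z) *\<^sub>R x)"

text \<open>
  The factor 1/2 turns the Frobenius inner product of matrices into the inner product of
  bivectors; see \<open>inner_biv_wedge\<close> and \<open>span_wedge\<close> below.
\<close>

definition inner_biv :: "real ^ 'n ^ 'n \<Rightarrow> real ^ 'n ^ 'n \<Rightarrow> real" where
  "inner_biv A B = (A \<bullet> B) / 2"


section \<open>Algebraic curvature operators\<close>

definition curvature_tensor ::
    "(real ^ 'n ^ 'n \<Rightarrow> real ^ 'n ^ 'n) \<Rightarrow> real ^ 'n \<Rightarrow> real ^ 'n \<Rightarrow> real ^ 'n \<Rightarrow> real ^ 'n \<Rightarrow> real" where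
  "curvature_tensor R x y z w = inner_biv (R (wedge x y)) (wedge z w)"

definition self_adjoint_biv :: "(real ^ 'n ^ 'n \<Rightarrow> real ^ 'n ^ 'n) \<Rightarrow> bool" where
  "self_adjoint_biv R \<longleftrightarrow>
     (\<forall>A\<in>bivectors. R A \<in> bivectors) \<and>
     (\<forall>A\<in>bivectors. \<forall>B\<in>bivectors. R (A + B) = R A + R B) \<and>
     (\<forall>c. \<forall>A\<in>bivectors. R (c *\<^sub>R A) = c *\<^sub>R R A) \<and>
     (\<forall>A\<in>bivectors. \<forall>B\<in>bivectors. inner_biv (R A) B = inner_biv A (R B))"

definition algebraic_curvature_operator :: "(real ^ 'n ^ 'n \<Rightarrow> real ^ 'n ^ 'n) \<Rightarrow> bool" where
  "algebraic_curvature_operator R \<longleftrightarrow>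
     self_adjoint_biv R \<and>
     (\<forall>x y z w. curvature_tensor R x y z w + curvature_tensor R y z x w
                + curvature_tensor R z x y w = 0)"

definition Ric :: "(real ^ 'n ^ 'n \<Rightarrow> real ^ 'n ^ 'n) \<Rightarrow> real ^ 'n \<Rightarrow> real ^ 'n \<Rightarrow> real" where
  "Ric R x y = (\<Sum>e\<in>Basis. curvature_tensor R x e y e)"


section \<open>Symmetric two-tensors\<close>

definition symmetric_two_tensor :: "(real ^ 'n \<Rightarrow> real ^ 'n \<Rightarrow> real) \<Rightarrow> bool" where
  "symmetric_two_tensor h \<longleftrightarrow> bilinear h \<and> (\<forall>x y. h x y = h y x)"

definition trace_free :: "(real ^ 'n \<Rightarrow> real ^ 'n \<Rightarrow> real) \<Rightarrow> bool" where
  "trace_free h \<longleftrightarrow> (\<Sum>e\<in>Basis. h e e) = 0"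

definition tensor_norm :: "(real ^ 'n \<Rightarrow> real ^ 'n \<Rightarrow> real) \<Rightarrow> real" where
  "tensor_norm h = sqrt (\<Sum>e\<in>Basis. \<Sum>f\<in>Basis. (h e f)\<^sup>2)"

definition biv_act ::
    "real ^ 'n ^ 'n \<Rightarrow> (real ^ 'n \<Rightarrow> real ^ 'n \<Rightarrow> real) \<Rightarrow> real ^ 'n \<Rightarrow> real ^ 'n \<Rightarrow> real" where
  "biv_act L h = (\<lambda>x y. - h (L *v x) y - h x (L *v y))"


section \<open>Ordered eigenbases\<close>

text \<open>An orthonormal eigenbasis and its eigenvalues are indexed by \<open>{1..N}\<close>, with
  \<open>N = CARD('n) choose 2\<close> the dimension of the space of bivectors.\<close>

definition ordered_eigenbasis ::
    "(real ^ 'n ^ 'n \<Rightarrow> real ^ 'n ^ 'n) \<Rightarrow> (nat \<Rightarrow> real) \<Rightarrow> (nat \<Rightarrow> real ^ 'n ^ 'n) \<Rightarrow> bool" where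
  "ordered_eigenbasis R l \<eta> \<longleftrightarrow>
     (\<forall>i\<in>{1..CARD('n) choose 2}. \<eta> i \<in> bivectors \<and> R (\<eta> i) = l i *\<^sub>R \<eta> i) \<and>
     (\<forall>i\<in>{1..CARD('n) choose 2}. \<forall>j\<in>{1..CARD('n) choose 2}.
        inner_biv (\<eta> i) (\<eta> j) = (if i = j then 1 else 0)) \<and>
     mono_on {1..CARD('n) choose 2} l"

text \<open>
  For self-adjoint \<open>R\<close> a choice exists (\<open>ordered_eigenbasis_exists\<close>), and neither the
  eigenvalues nor the quantity \<open>Q R h\<close> below depend on it (\<open>eigval_eq\<close>, \<open>Q_eq\<close>).
\<close>

definition eigensystem ::
    "(real ^ 'n ^ 'n \<Rightarrow> real ^ 'n ^ 'n) \<Rightarrow> (nat \<Rightarrow> real) \<times> (nat \<Rightarrow> real ^ 'n ^ 'n)" where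
  "eigensystem R = (SOME p. ordered_eigenbasis R (fst p) (snd p))"

definition eigval :: "(real ^ 'n ^ 'n \<Rightarrow> real ^ 'n ^ 'n) \<Rightarrow> nat \<Rightarrow> real" where
  "eigval R = fst (eigensystem R)"

definition eigvec :: "(real ^ 'n ^ 'n \<Rightarrow> real ^ 'n ^ 'n) \<Rightarrow> nat \<Rightarrow> real ^ 'n ^ 'n" where
  "eigvec R = snd (eigensystem R)"

definition Q :: "(real ^ 'n ^ 'n \<Rightarrow> real ^ 'n ^ 'n) \<Rightarrow> (real ^ 'n \<Rightarrow> real ^ 'n \<Rightarrow> real) \<Rightarrow> real" where
  "Q R h = (\<Sum>i = 1..CARD('n) choose 2. eigval R i * (tensor_norm (biv_act (eigvec R i) h))\<^sup>2)"

text \<open>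
  These two are meant for \<open>1 \<le> k \<le> CARD('n) choose 2\<close>. For integral \<open>k\<close> the last term of
  \<open>eigval_sum\<close> vanishes, so no eigenvalue of index greater than \<open>CARD('n) choose 2\<close> contributes.
\<close>

definition eigval_sum :: "real \<Rightarrow> (real ^ 'n ^ 'n \<Rightarrow> real ^ 'n ^ 'n) \<Rightarrow> real" where
  "eigval_sum k R =
     (\<Sum>i = 1..nat \<lfloor>k\<rfloor>. eigval R i) + (k - of_int \<lfloor>k\<rfloor>) * eigval R (nat \<lfloor>k\<rfloor> + 1)"

definition k_nonnegative :: "real \<Rightarrow> (real ^ 'n ^ 'n \<Rightarrow> real ^ 'n ^ 'n) \<Rightarrow> bool" where
  "k_nonnegative k R \<longleftrightarrow> 0 \<le> eigval_sum k R"


section \<open>Bivectors: adequacy of the model\<close>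

lemma wedge_component: "wedge x y $ i $ j = x $ j * y $ i - y $ j * x $ i"
  by (simp add: wedge_def matrix_def inner_axis)

lemma wedge_mult_vec: "wedge x y *v z = (x \<bullet> z) *\<^sub>R y - (y \<bullet> z) *\<^sub>R x"
  by (simp add: vec_eq_iff matrix_vector_mult_def wedge_component inner_vec_def
      sum_subtractf sum_distrib_left sum_distrib_right algebra_simps)

lemma bivectors_iff: "A \<in> bivectors \<longleftrightarrow> (\<forall>i j. A $ i $ j = - A $ j $ i)"
  by (auto simp: bivectors_def transpose_def vec_eq_iff)

lemma subspace_bivectors: "subspace (bivectors :: (real ^ 'a ^ 'a) set)"
proof -
  have "transpose (A + B) = transpose A + transpose B" "transpose (c *\<^sub>R A) = c *\<^sub>R transpose A"
    "transpose (0 :: real ^ 'a ^ 'a) = 0" for A B :: "real ^ 'a ^ 'a" and c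
    by (simp_all add: transpose_def vec_eq_iff)
  then show ?thesis
    by (simp add: subspace_def bivectors_def)
qed

lemma wedge_in_bivectors [simp]: "wedge x y \<in> bivectors"
  by (simp add: bivectors_iff wedge_component)

lemma inner_biv_wedge:
  "inner_biv (wedge x y) (wedge z w) = (x \<bullet> z) * (y \<bullet> w) - (x \<bullet> w) * (y \<bullet> z)"
proof -
  have "wedge x y \<bullet> wedge z w =
      (\<Sum>i\<in>UNIV. \<Sum>j\<in>UNIV. (x $ j * z $ j) * (y $ i * w $ i)) - (\<Sum>i\<in>UNIV. \<Sum>j\<in>UNIV. (x $ j * w $ j) * (y $ i * z $ i))
    - (\<Sum>i\<in>UNIV. \<Sum>j\<in>UNIV. (y $ j * z $ j) * (x $ i * w $ i)) + (\<Sum>i\<in>UNIV. \<Sum>j\<in>UNIV. (y $ j * w $ j) * (x $ i * z $ i))"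
    unfolding sum_subtractf [symmetric] sum.distrib [symmetric]
    by (simp add: inner_vec_def wedge_component algebra_simps)
  also have "\<dots> = 2 * ((x \<bullet> z) * (y \<bullet> w) - (x \<bullet> w) * (y \<bullet> z))"
    by (simp add: inner_vec_def sum_distrib_left [symmetric] sum_distrib_right [symmetric])
  finally show ?thesis by (simp add: inner_biv_def)
qed

lemma bivector_expand:
  assumes "A \<in> bivectors"
  shows "A = (\<Sum>i\<in>UNIV. \<Sum>j\<in>UNIV. (A $ j $ i / 2) *\<^sub>R wedge (axis i 1) (axis j 1))"
proof -
  have "(\<Sum>i\<in>UNIV. \<Sum>j\<in>UNIV. (A $ j $ i / 2) *\<^sub>R wedge (axis i 1) (axis j 1)) $ a $ b = A $ a $ b" for a b
  proof -
    have "(\<Sum>i\<in>UNIV. \<Sum>j\<in>UNIV. (A $ j $ i / 2) *\<^sub>R wedge (axis i 1) (axis j 1)) $ a $ b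
       = (\<Sum>i\<in>UNIV. \<Sum>j\<in>UNIV. (if i = b then if j = a then A $ j $ i / 2 else 0 else 0))
         - (\<Sum>i\<in>UNIV. \<Sum>j\<in>UNIV. (if i = a then if j = b then A $ j $ i / 2 else 0 else 0))"
      unfolding sum_subtractf [symmetric]
      by (auto simp: wedge_component axis_def intro!: sum.cong)
    also have "\<dots> = A $ a $ b / 2 - A $ b $ a / 2"
    proof -
      have *: "(\<Sum>i\<in>UNIV. \<Sum>j\<in>UNIV. (if i = c then if j = d then A $ j $ i / 2 else 0 else 0))
          = A $ d $ c / 2" for c d
      proof -
        have "(\<Sum>i\<in>UNIV. \<Sum>j\<in>UNIV. (if i = c then if j = d then A $ j $ i / 2 else 0 else 0))
          = (\<Sum>i\<in>UNIV. if i = c then A $ d $ c / 2 else 0)"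
          by (rule sum.cong) auto
        also have "\<dots> = A $ d $ c / 2" by simp
        finally show ?thesis .
      qed
      show ?thesis unfolding * ..
    qed
    also have "A $ b $ a = - A $ a $ b"
      using assms bivectors_iff by blast
    also have "A $ a $ b / 2 - - A $ a $ b / 2 = A $ a $ b"
      by simp
    finally show ?thesis .
  qed
  then show ?thesis by (simp add: vec_eq_iff)
qed

lemma span_wedge: "span {wedge x y | x y. True} = bivectors"
proof
  show "span {wedge x y |x y. True} \<subseteq> bivectors"
    by (rule span_minimal) (auto simp: subspace_bivectors)
  show "bivectors \<subseteq> span {wedge x y |x y. True}"
  proof
    fix A :: "real ^ 'n ^ 'n" assume "A \<in> bivectors"
    show "A \<in> span {wedge x y |x y. True}"
      by (subst bivector_expand [OF \<open>A \<in> bivectors\<close>]) (intro span_sum span_scale span_base, blast)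
  qed
qed

lemma dim_bivectors: "dim (bivectors :: (real ^ 'n ^ 'n) set) = CARD('n::finite) choose 2"
proof -
  obtain f :: "'n \<Rightarrow> nat" where f: "inj f"
    using finite_imp_inj_to_nat_seg [OF finite [of "UNIV :: 'n set"]] by blast
  define P where "P = {(i, j). f i < f j}"
  define w :: "'n \<times> 'n \<Rightarrow> real ^ 'n ^ 'n" where "w = (\<lambda>(i, j). wedge (axis i 1) (axis j 1))"
  have ip: "inner_biv (w p) (w q) = (if p = q then 1 else 0)" if "p \<in> P" "q \<in> P" for p q
    using that by (auto simp: w_def P_def inner_biv_wedge inner_axis_axis split: prod.splits)
  have inj: "inj_on w P"
  proof (rule inj_onI)
    fix p q assume "p \<in> P" "q \<in> P" "w p = w q"
    then show "p = q" using ip [of p q] ip [of q q] by (auto split: if_splits)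
  qed
  have nz: "0 \<notin> w ` P"
  proof
    assume "0 \<in> w ` P"
    then obtain p where "p \<in> P" "w p = 0" by auto
    then show False using ip [of p p] by (simp add: inner_biv_def)
  qed
  have orth: "pairwise orthogonal (w ` P)"
  proof (rule pairwiseI)
    fix a b assume "a \<in> w ` P" "b \<in> w ` P" "a \<noteq> b"
    then obtain p q where "p \<in> P" "q \<in> P" "p \<noteq> q" "a = w p" "b = w q" by auto
    then show "orthogonal a b" using ip [of p q] by (simp add: orthogonal_def inner_biv_def)
  qed
  have indep: "independent (w ` P)"
    using orth nz by (rule pairwise_orthogonal_independent)
  have swap: "wedge x y = - wedge y x" for x y :: "real ^ 'n"
    by (simp add: vec_eq_iff wedge_component)
  have mem: "wedge (axis i 1) (axis j 1) \<in> span (w ` P)" for i j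
  proof -
    consider "i = j" | "f i < f j" | "f j < f i"
      using f by (metis injD linorder_neqE_nat)
    then show ?thesis
    proof cases
      case 1
      then have "wedge (axis i 1) (axis j 1) = (0 :: real ^ 'n ^ 'n)"
        by (simp add: vec_eq_iff wedge_component)
      then show ?thesis by (simp add: span_zero)
    next
      case 2
      then have "w (i, j) \<in> w ` P" by (auto simp: P_def)
      then show ?thesis by (simp add: w_def span_base)
    next
      case 3
      then have "w (j, i) \<in> w ` P" by (auto simp: P_def)
      then show ?thesis
        by (subst swap) (simp add: w_def span_base span_neg)
    qed
  qed
  have span: "span (w ` P) = bivectors"
  proof
    show "span (w ` P) \<subseteq> bivectors"
      by (rule span_minimal) (auto simp: subspace_bivectors w_def)
    show "bivectors \<subseteq> span (w ` P)"
    proof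
      fix A :: "real ^ 'n ^ 'n" assume "A \<in> bivectors"
      show "A \<in> span (w ` P)"
        by (subst bivector_expand [OF \<open>A \<in> bivectors\<close>]) (intro span_sum span_scale mem)
    qed
  qed
  have "bij_betw (\<lambda>(i, j). {i, j}) P {X. card X = 2}"
    unfolding bij_betw_def
  proof
    show "inj_on (\<lambda>(i, j). {i, j}) P"
      by (auto simp: inj_on_def P_def doubleton_eq_iff)
    show "(\<lambda>(i, j). {i, j}) ` P = {X. card X = 2}"
    proof safe
      fix i j assume "(i, j) \<in> P"
      then have "i \<noteq> j" by (auto simp: P_def)
      then show "card {i, j} = 2" by simp
    next
      fix X :: "'n set" assume "card X = 2"
      then obtain a b where X: "X = {a, b}" "a \<noteq> b" by (auto simp: card_2_iff)
      then have "f a < f b \<or> f b < f a" using f by (metis injD linorder_neqE_nat)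
      then have "(a, b) \<in> P \<or> (b, a) \<in> P" by (auto simp: P_def)
      then show "X \<in> (\<lambda>(i, j). {i, j}) ` P"
        using X by (force simp: insert_commute)
    qed
  qed
  then have "card P = CARD('n) choose 2"
    using n_subsets [of "UNIV :: 'n set" 2] by (simp add: bij_betw_same_card)
  then have "card (w ` P) = CARD('n) choose 2"
    using inj by (simp add: card_image)
  then show ?thesis
    using indep span by (metis dim_eq_card_independent dim_span)
qed


section \<open>Existence and uniqueness for ordered eigenbases\<close>

lemma self_adjoint_eigenvector:
  fixes f :: "'a::euclidean_space \<Rightarrow> 'a"
  assumes f: "linear f" and S: "subspace S" "S \<noteq> {0}" and inv: "\<And>x. x \<in> S \<Longrightarrow> f x \<in> S"
    and sa: "\<And>x y. x \<in> S \<Longrightarrow> y \<in> S \<Longrightarrow> f x \<bullet> y = x \<bullet> f y"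
  obtains v c where "v \<in> S" "norm v = 1" "f v = c *\<^sub>R v"
proof -
  interpret f: linear f by fact
  let ?K = "S \<inter> sphere 0 1"
  have "compact ?K"
    using S(1) by (simp add: closed_subspace closed_Int_compact)
  moreover have "?K \<noteq> {}"
  proof -
    obtain x where x: "x \<in> S" "x \<noteq> 0"
      using S subspace_0 by blast
    then have "(1 / norm x) *\<^sub>R x \<in> ?K"
      using S(1) by (simp add: subspace_scale)
    then show ?thesis by blast
  qed
  moreover have "continuous_on ?K (\<lambda>x. x \<bullet> f x)"
    by (intro continuous_intros linear_continuous_on linear_conv_bounded_linear [THEN iffD1] f)
  ultimately obtain v where v: "v \<in> ?K" and max: "\<And>x. x \<in> ?K \<Longrightarrow> x \<bullet> f x \<le> v \<bullet> f v"
    by (metis continuous_attains_sup)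
  define c where "c = v \<bullet> f v"
  have vS: "v \<in> S" and vv: "v \<bullet> v = 1"
    using v by (auto simp: dot_square_norm)
  have bound: "x \<bullet> f x \<le> c * (x \<bullet> x)" if x: "x \<in> S" for x
  proof (cases "x = 0")
    case False
    have "(1 / norm x) *\<^sub>R x \<in> ?K"
      using x False S(1) by (simp add: subspace_scale)
    from max [OF this] False show ?thesis
      by (simp add: f.scale c_def dot_square_norm field_simps power2_eq_square)
  qed (simp add: f.zero)
  define w where "w = f v - c *\<^sub>R v"
  have wS: "w \<in> S"
    using S(1) vS by (simp add: w_def inv subspace_diff subspace_scale)
  have wv: "w \<bullet> v = 0"
    using vv by (subst inner_commute) (simp add: w_def c_def inner_diff_right)
  have wf: "w \<bullet> f v = w \<bullet> w"
    using wv by (simp add: w_def inner_diff_right inner_diff_left)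
  have vf: "v \<bullet> f w = w \<bullet> w"
    using sa [OF vS wS] wf by (simp add: inner_commute)
  have ineq: "2 * t * (w \<bullet> w) \<le> t\<^sup>2 * (c * (w \<bullet> w) - w \<bullet> f w)" for t
  proof -
    have "v + t *\<^sub>R w \<in> S"
      using S(1) vS wS by (simp add: subspace_add subspace_scale)
    from bound [OF this] show ?thesis
      using wv vv vf wf
      by (simp add: f.add f.scale inner_add_left inner_add_right inner_commute c_def [symmetric]
          power2_eq_square algebra_simps)
  qed
  have "w \<bullet> w = 0"
  proof (rule ccontr)
    assume "w \<bullet> w \<noteq> 0"
    then have pos: "w \<bullet> w > 0" by simp
    define M where "M = \<bar>c * (w \<bullet> w) - w \<bullet> f w\<bar> + 1"
    define t where "t = (w \<bullet> w) / M"
    have M: "M > 0" "c * (w \<bullet> w) - w \<bullet> f w \<le> M" by (auto simp: M_def)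
    have t: "t > 0" using pos M by (simp add: t_def)
    have "2 * t * (w \<bullet> w) \<le> t\<^sup>2 * M"
      using ineq [of t] mult_left_mono [OF M(2), of "t\<^sup>2"] by simp
    also have "\<dots> = t * (w \<bullet> w)"
      using M by (simp add: t_def power2_eq_square)
    finally show False using t pos by simp
  qed
  then have "f v = c *\<^sub>R v" by (simp add: w_def)
  with v show ?thesis by (intro that) auto
qed

lemma self_adjoint_eigenbasis:
  fixes f :: "'a::euclidean_space \<Rightarrow> 'a"
  assumes f: "linear f"
  shows "subspace S \<Longrightarrow> (\<And>x. x \<in> S \<Longrightarrow> f x \<in> S) \<Longrightarrow>
    (\<And>x y. x \<in> S \<Longrightarrow> y \<in> S \<Longrightarrow> f x \<bullet> y = x \<bullet> f y) \<Longrightarrow>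
    \<exists>B c. pairwise orthogonal B \<and> span B = S \<and> (\<forall>b\<in>B. norm b = 1 \<and> f b = c b *\<^sub>R b)"
proof (induction "dim S" arbitrary: S rule: less_induct)
  case less
  show ?case
  proof (cases "S = {0}")
    case True
    then show ?thesis by (intro exI [of _ "{}"]) auto
  next
    case False
    obtain v d where v: "v \<in> S" "norm v = 1" "f v = d *\<^sub>R v"
      using self_adjoint_eigenvector [OF f less.prems(1) False less.prems(2,3)] by blast
    then have vv: "v \<bullet> v = 1" by (simp add: dot_square_norm)
    define T where "T = {x \<in> S. x \<bullet> v = 0}"
    have T: "subspace T"
      using less.prems(1) by (auto simp: T_def subspace_def inner_add_left)
    have "v \<notin> T" using vv by (simp add: T_def)
    moreover have "T \<subseteq> S" by (auto simp: T_def)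
    ultimately have "T \<subset> S" using v(1) by blast
    then have lt: "dim T < dim S"
      using T less.prems(1) by (intro dim_psubset) (simp add: span_eq_iff [THEN iffD2])
    have "f x \<in> T" if "x \<in> T" for x
      using that less.prems(2,3) v by (simp add: T_def)
    moreover have "f x \<bullet> y = x \<bullet> f y" if "x \<in> T" "y \<in> T" for x y
      using that less.prems(3) by (simp add: T_def)
    ultimately obtain B c where B: "pairwise orthogonal B" "span B = T"
        "\<forall>b\<in>B. norm b = 1 \<and> f b = c b *\<^sub>R b"
      using less.hyps [OF lt T] by blast
    have BT: "B \<subseteq> T" using B(2) span_superset by blast
    have "span (insert v B) = S"
    proof
      show "span (insert v B) \<subseteq> S"
        using BT \<open>T \<subset> S\<close> v(1) less.prems(1) by (intro span_minimal) auto
      show "S \<subseteq> span (insert v B)"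
      proof
        fix x assume "x \<in> S"
        then have "x - (x \<bullet> v) *\<^sub>R v \<in> T"
          using vv v(1) less.prems(1)
          by (simp add: T_def inner_diff_left subspace_diff subspace_scale)
        then show "x \<in> span (insert v B)"
          unfolding span_insert using B(2) by blast
      qed
    qed
    moreover have "pairwise orthogonal (insert v B)"
      using B(1) BT by (auto simp: pairwise_insert T_def orthogonal_def inner_commute)
    moreover have "\<forall>b\<in>insert v B. norm b = 1 \<and> f b = (c(v := d)) b *\<^sub>R b"
      using B(3) v by auto
    ultimately show ?thesis by blast
  qed
qed

lemma self_adjoint_biv_extend_linear:
  fixes R :: "real ^ 'n ^ 'n \<Rightarrow> real ^ 'n ^ 'n"
  assumes R: "self_adjoint_biv R"
  obtains f where "linear f" "\<And>A. A \<in> bivectors \<Longrightarrow> f A = R A"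
proof -
  obtain B where B: "B \<subseteq> (bivectors :: (real ^ 'n ^ 'n) set)" "independent B" "bivectors \<subseteq> span B"
    using basis_exists by metis
  then obtain f where f: "linear f" "\<forall>x\<in>B. f x = R x"
    using linear_independent_extend by blast
  interpret f: linear f by fact
  have "A \<in> bivectors \<and> f A = R A" if "A \<in> span B" for A
    using that
  proof (induction rule: span_induct_alt)
    case base
    have "R (0 *\<^sub>R 0) = 0 *\<^sub>R R 0"
      using R subspace_0 [OF subspace_bivectors] unfolding self_adjoint_biv_def by blast
    then show ?case
      by (simp add: f.zero subspace_0 [OF subspace_bivectors])
  next
    case (step c x y)
    then have "x \<in> bivectors" using B by blast
    moreover from this have "c *\<^sub>R x \<in> bivectors"
      by (simp add: subspace_scale subspace_bivectors)
    ultimately show ?case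
      using step R f(2) 
      by (simp add: self_adjoint_biv_def f.add f.scale subspace_add subspace_bivectors)
  qed
  then show ?thesis using that f(1) B(3) by blast
qed

lemma ordered_eigenbasis_exists:
  assumes R: "self_adjoint_biv (R :: real ^ 'n ^ 'n \<Rightarrow> real ^ 'n ^ 'n)"
  shows "\<exists>l \<eta>. ordered_eigenbasis R l \<eta>"
proof -
  obtain f where f: "linear f" and fR: "\<And>A. A \<in> bivectors \<Longrightarrow> f A = R A"
    using self_adjoint_biv_extend_linear [OF R] by blast
  have "\<exists>B c. pairwise orthogonal B \<and> span B = (bivectors :: (real ^ 'n ^ 'n) set)
      \<and> (\<forall>b\<in>B. norm b = 1 \<and> f b = c b *\<^sub>R b)"
    using R by (intro self_adjoint_eigenbasis f subspace_bivectors)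
               (auto simp: fR self_adjoint_biv_def inner_biv_def)
  then obtain B c where B: "pairwise orthogonal B" "span B = (bivectors :: (real ^ 'n ^ 'n) set)"
      "\<And>b. b \<in> B \<Longrightarrow> norm b = 1" "\<And>b. b \<in> B \<Longrightarrow> f b = c b *\<^sub>R b"
    by blast
  have "0 \<notin> B" using B(3) by force
  then have indep: "independent B" using B(1) by (simp add: pairwise_orthogonal_independent)
  then have fin: "finite B" by (rule independent_imp_finite)
  have card: "card B = CARD('n) choose 2"
    using indep B(2) by (metis dim_bivectors dim_eq_card_independent dim_span)
  obtain xs where xs: "set xs = B" "distinct xs"
    using fin finite_distinct_list by blast
  define ys where "ys = sort_key c xs"
  have ys: "set ys = B" "distinct ys" "sorted (map c ys)"
    using xs by (auto simp: ys_def)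
  have len: "length ys = CARD('n) choose 2"
    using ys card distinct_card by metis
  define \<eta> where "\<eta> = (\<lambda>i. sqrt 2 *\<^sub>R ys ! (i - 1))"
  define l where "l = (\<lambda>i. c (ys ! (i - 1)))"
  have mem: "ys ! (i - 1) \<in> B" if "i \<in> {1..CARD('n) choose 2}" for i
    using that len ys(1) by (auto simp: nth_mem)
  have memb: "ys ! (i - 1) \<in> bivectors" if "i \<in> {1..CARD('n) choose 2}" for i
    using mem [OF that] B(2) span_base by blast
  have "\<eta> i \<in> bivectors \<and> R (\<eta> i) = l i *\<^sub>R \<eta> i" if i: "i \<in> {1..CARD('n) choose 2}" for i
  proof
    have "R (ys ! (i - 1)) = l i *\<^sub>R ys ! (i - 1)"
      using B(4) [OF mem [OF i]] fR [OF memb [OF i]] by (simp add: l_def)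
    then show "R (\<eta> i) = l i *\<^sub>R \<eta> i"
      using R memb [OF i] by (simp add: self_adjoint_biv_def \<eta>_def)
    show "\<eta> i \<in> bivectors"
      using memb [OF i] by (simp add: \<eta>_def subspace_scale subspace_bivectors)
  qed
  moreover have "inner_biv (\<eta> i) (\<eta> j) = (if i = j then 1 else 0)"
    if i: "i \<in> {1..CARD('n) choose 2}" and j: "j \<in> {1..CARD('n) choose 2}" for i j
  proof (cases "i = j")
    case True
    then show ?thesis
      using B(3) [OF mem [OF i]] by (simp add: \<eta>_def inner_biv_def dot_square_norm)
  next
    case False
    then have "ys ! (i - 1) \<noteq> ys ! (j - 1)"
      using i j len ys(2) by (auto simp: nth_eq_iff_index_eq)
    then have "ys ! (i - 1) \<bullet> ys ! (j - 1) = 0"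
      using B(1) mem i j unfolding pairwise_def orthogonal_def by blast
    then show ?thesis using False by (simp add: \<eta>_def inner_biv_def)
  qed
  moreover have "mono_on {1..CARD('n) choose 2} l"
  proof (rule mono_onI)
    fix i j assume "i \<in> {1..CARD('n) choose 2}" "j \<in> {1..CARD('n) choose 2}" "i \<le> j"
    then have "map c ys ! (i - 1) \<le> map c ys ! (j - 1)"
      using len by (intro sorted_nth_mono [OF ys(3)]) auto
    then show "l i \<le> l j"
      using \<open>i \<in> _\<close> \<open>j \<in> _\<close> len by (auto simp: l_def)
  qed
  ultimately show ?thesis unfolding ordered_eigenbasis_def by blast
qed

lemma ordered_eigenbasis_eigensystem:
  assumes "self_adjoint_biv R"
  shows "ordered_eigenbasis R (eigval R) (eigvec R)"
proof -
  obtain l \<eta> where "ordered_eigenbasis R l \<eta>"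
    using ordered_eigenbasis_exists [OF assms] by blast
  then have "ordered_eigenbasis R (fst (l, \<eta>)) (snd (l, \<eta>))" by simp
  then show ?thesis
    unfolding eigval_def eigvec_def eigensystem_def by (rule someI)
qed

lemma ordered_eigenbasis_expand:
  fixes R :: "real ^ 'n ^ 'n \<Rightarrow> real ^ 'n ^ 'n"
  assumes e: "ordered_eigenbasis R l \<eta>" and A: "A \<in> bivectors"
  shows "A = (\<Sum>i = 1..CARD('n) choose 2. inner_biv A (\<eta> i) *\<^sub>R \<eta> i)"
proof -
  let ?I = "{1..CARD('n) choose 2}"
  have ip: "\<eta> i \<bullet> \<eta> j = (if i = j then 2 else 0)" if "i \<in> ?I" "j \<in> ?I" for i j
  proof -
    have "inner_biv (\<eta> i) (\<eta> j) = (if i = j then 1 else 0)"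
      using e that unfolding ordered_eigenbasis_def by blast
    then show ?thesis by (simp add: inner_biv_def split: if_splits)
  qed
  have inj: "inj_on \<eta> ?I"
  proof (rule inj_onI)
    fix i j assume "i \<in> ?I" "j \<in> ?I" "\<eta> i = \<eta> j"
    then show "i = j" using ip [of i j] ip [of j j] by (auto split: if_splits)
  qed
  have "pairwise orthogonal (\<eta> ` ?I)"
    using ip by (auto simp: pairwise_def orthogonal_def)
  moreover have "0 \<notin> \<eta> ` ?I"
  proof
    assume "0 \<in> \<eta> ` ?I"
    then obtain i where "i \<in> ?I" "\<eta> i = 0" by auto
    then show False using ip [of i i] by simp
  qed
  ultimately have indep: "independent (\<eta> ` ?I)"
    by (rule pairwise_orthogonal_independent)
  have sub: "\<eta> ` ?I \<subseteq> bivectors"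
    using e by (auto simp: ordered_eigenbasis_def)
  have "card (\<eta> ` ?I) = CARD('n) choose 2"
    using inj by (simp add: card_image)
  then have "bivectors \<subseteq> span (\<eta> ` ?I)"
    using indep sub by (intro card_ge_dim_independent) (auto simp: dim_bivectors)
  then have "A \<in> span (\<eta> ` ?I)" using A by blast
  then obtain u where "A = (\<Sum>v\<in>\<eta> ` ?I. u v *\<^sub>R v)"
    by (auto simp: span_finite)
  then have A: "A = (\<Sum>i\<in>?I. u (\<eta> i) *\<^sub>R \<eta> i)"
    using inj by (simp add: sum.reindex)
  have "inner_biv A (\<eta> j) = u (\<eta> j)" if j: "j \<in> ?I" for j
  proof -
    have "A \<bullet> \<eta> j = (\<Sum>i\<in>?I. u (\<eta> i) * (\<eta> i \<bullet> \<eta> j))"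
      by (subst A) (simp add: inner_sum_left)
    also have "\<dots> = (\<Sum>i\<in>?I. if i = j then 2 * u (\<eta> i) else 0)"
      using j by (intro sum.cong) (auto simp: ip)
    also have "\<dots> = 2 * u (\<eta> j)" using j by simp
    finally show ?thesis by (simp add: inner_biv_def)
  qed
  then show ?thesis by (subst A) (auto intro!: sum.cong)
qed

lemma eigenspace_dim:
  fixes R :: "real ^ 'n ^ 'n \<Rightarrow> real ^ 'n ^ 'n"
  assumes R: "self_adjoint_biv R" and e: "ordered_eigenbasis R l \<eta>"
  shows "card {i \<in> {1..CARD('n) choose 2}. l i = t} = dim {A \<in> bivectors. R A = t *\<^sub>R A}"
proof -
  let ?I = "{1..CARD('n) choose 2}"
  let ?J = "{i \<in> ?I. l i = t}"
  have ip: "\<eta> i \<bullet> \<eta> j = (if i = j then 2 else 0)" if "i \<in> ?I" "j \<in> ?I" for i j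
  proof -
    have "inner_biv (\<eta> i) (\<eta> j) = (if i = j then 1 else 0)"
      using e that unfolding ordered_eigenbasis_def by blast
    then show ?thesis by (simp add: inner_biv_def split: if_splits)
  qed
  have eb: "\<eta> i \<in> bivectors" "R (\<eta> i) = l i *\<^sub>R \<eta> i" if "i \<in> ?I" for i
    using e that by (auto simp: ordered_eigenbasis_def)
  have inj: "inj_on \<eta> ?J"
  proof (rule inj_onI)
    fix i j assume "i \<in> ?J" "j \<in> ?J" "\<eta> i = \<eta> j"
    then show "i = j" using ip [of i j] ip [of j j] by (auto split: if_splits)
  qed
  have "pairwise orthogonal (\<eta> ` ?J)"
    using ip by (auto simp: pairwise_def orthogonal_def)
  moreover have "0 \<notin> \<eta> ` ?J"
  proof
    assume "0 \<in> \<eta> ` ?J"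
    then obtain i where "i \<in> ?I" "\<eta> i = 0" by auto
    then show False using ip [of i i] by simp
  qed
  ultimately have indep: "independent (\<eta> ` ?J)"
    by (rule pairwise_orthogonal_independent)
  have "{A \<in> bivectors. R A = t *\<^sub>R A} \<subseteq> span (\<eta> ` ?J)"
  proof clarify
    fix A assume A: "A \<in> bivectors" "R A = t *\<^sub>R A"
    have "inner_biv A (\<eta> i) *\<^sub>R \<eta> i \<in> span (\<eta> ` ?J)" if i: "i \<in> ?I" for i
    proof (cases "l i = t")
      case True
      then show ?thesis using i by (intro span_scale span_base) auto
    next
      case False
      have "inner_biv (R A) (\<eta> i) = inner_biv A (R (\<eta> i))"
        using R A(1) eb(1) [OF i] by (simp add: self_adjoint_biv_def)
      then have "t * inner_biv A (\<eta> i) = l i * inner_biv A (\<eta> i)"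
        using A(2) eb(2) [OF i] by (simp add: inner_biv_def)
      then show ?thesis using False by (simp add: span_zero)
    qed
    then show "A \<in> span (\<eta> ` ?J)"
      using ordered_eigenbasis_expand [OF e A(1)] by (metis (no_types, lifting) span_sum)
  qed
  then have "dim {A \<in> bivectors. R A = t *\<^sub>R A} = card (\<eta> ` ?J)"
    using indep eb by (intro dim_unique [of "\<eta> ` ?J"]) auto
  then show ?thesis using inj by (simp add: card_image)
qed

lemma eigval_eq:
  fixes R :: "real ^ 'n ^ 'n \<Rightarrow> real ^ 'n ^ 'n"
  assumes R: "self_adjoint_biv R" and e: "ordered_eigenbasis R l \<eta>"
    and i: "i \<in> {1..CARD('n) choose 2}"
  shows "eigval R i = l i"
proof -
  let ?N = "CARD('n) choose 2"
  note e' = ordered_eigenbasis_eigensystem [OF R]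
  have srt: "sorted (map k [1..<Suc ?N])" if "ordered_eigenbasis R k \<theta>" for k \<theta>
  proof -
    have "mono_on {1..?N} k" using that by (simp add: ordered_eigenbasis_def)
    then show ?thesis
      by (auto simp: sorted_iff_nth_mono_less mono_on_def simp del: upt_Suc)
  qed
  have cnt: "count (mset (map k [1..<Suc ?N])) t = dim {A \<in> bivectors. R A = t *\<^sub>R A}"
    if "ordered_eigenbasis R k \<theta>" for k \<theta> t
  proof -
    have "count (mset (map k [1..<Suc ?N])) t = card {i \<in> {1..?N}. k i = t}"
      unfolding count_mset count_list_eq_length_filter filter_map o_def length_map
      by (subst distinct_length_filter) (auto simp del: upt_Suc intro!: arg_cong [where f = card])
    then show ?thesis using eigenspace_dim [OF R that] by simp
  qed
  have "mset (map (eigval R) [1..<Suc ?N]) = mset (map l [1..<Suc ?N])"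
    by (rule multiset_eqI) (simp only: cnt [OF e] cnt [OF e'])
  then have "map (eigval R) [1..<Suc ?N] = map l [1..<Suc ?N]"
    using srt [OF e] srt [OF e'] properties_for_sort sorted_sort_id by metis
  then show ?thesis using i by (simp add: map_eq_conv del: upt_Suc)
qed

lemma tensor_norm_biv_act_squared:
  "(tensor_norm (biv_act A h))\<^sup>2
     = (\<Sum>e\<in>Basis. \<Sum>f\<in>Basis. biv_act A h e f * biv_act A h e f)"
  unfolding tensor_norm_def by (simp add: power2_eq_square sum_nonneg)

lemma Q_eq:
  fixes R :: "real ^ 'n ^ 'n \<Rightarrow> real ^ 'n ^ 'n"
  assumes R: "self_adjoint_biv R" and h: "bilinear h" and e: "ordered_eigenbasis R l \<eta>"
  shows "Q R h = (\<Sum>i = 1..CARD('n) choose 2. l i * (tensor_norm (biv_act (\<eta> i) h))\<^sup>2)"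
proof -
  let ?I = "{1..CARD('n) choose 2}"
  define F where "F = (\<lambda>A B. \<Sum>e\<in>Basis. \<Sum>f\<in>Basis. biv_act A h e f * biv_act B h e f)"
  have act_lin: "linear (\<lambda>A. biv_act A h x y)" for x y
    using h unfolding biv_act_def
    by (intro linearI)
       (simp_all add: matrix_vector_mult_add_rdistrib scaleR_matrix_vector_assoc [symmetric]
          bilinear_ladd bilinear_radd bilinear_lmul bilinear_rmul algebra_simps)
  have tF: "(tensor_norm (biv_act A h))\<^sup>2 = F A A" for A
    by (simp add: tensor_norm_biv_act_squared F_def)
  have act_simps: "biv_act (A + B) h x y = biv_act A h x y + biv_act B h x y"
      "biv_act (c *\<^sub>R A) h x y = c * biv_act A h x y" for A B x y c
    using linear_add [OF act_lin] linear_scale [OF act_lin] by simp_all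
  have F1: "linear (\<lambda>A. F A B)" for B
    by (intro linearI)
       (simp_all add: F_def act_simps sum.distrib sum_distrib_left distrib_right mult.assoc)
  have F2: "F A B = F B A" for A B
    by (simp add: F_def mult.commute)
  have F3: "linear (\<lambda>B. F A B)" for A
    using F1 [of A] by (simp add: F2 [of A])
  note e' = ordered_eigenbasis_eigensystem [OF R]
  have Q': "(\<Sum>i\<in>?I. k i * (tensor_norm (biv_act (\<theta> i) h))\<^sup>2) = (\<Sum>i\<in>?I. F (R (\<theta> i)) (\<theta> i))"
    if "ordered_eigenbasis R k \<theta>" for k \<theta>
    using that
    by (intro sum.cong) (simp_all add: tF ordered_eigenbasis_def linear_scale [OF F1])
  obtain f where f: "linear f" and fR: "\<And>A. A \<in> bivectors \<Longrightarrow> f A = R A"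
    using self_adjoint_biv_extend_linear [OF R] by blast
  let ?\<theta> = "eigvec R"
  have mem: "\<eta> i \<in> bivectors" "?\<theta> i \<in> bivectors" if "i \<in> ?I" for i
    using that e e' by (auto simp: ordered_eigenbasis_def)
  have Ff: "linear (\<lambda>A. F (f A) B)" for B
    using linear_compose [OF f F1] by (simp add: o_def)
  have "(\<Sum>i\<in>?I. F (f (?\<theta> i)) (?\<theta> i))
      = (\<Sum>i\<in>?I. \<Sum>j\<in>?I. inner_biv (?\<theta> i) (\<eta> j) * F (f (?\<theta> i)) (\<eta> j))"
    (is "_ = (\<Sum>i\<in>_. ?r i)")
  proof (rule sum.cong)
    fix i assume "i \<in> ?I"
    have "F (f (?\<theta> i)) (?\<theta> i)
        = F (f (?\<theta> i)) (\<Sum>j\<in>?I. inner_biv (?\<theta> i) (\<eta> j) *\<^sub>R \<eta> j)"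
      using ordered_eigenbasis_expand [OF e mem(2) [OF \<open>i \<in> ?I\<close>]] by simp
    also have "\<dots> = ?r i"
      by (simp add: linear_sum [OF F3] linear_scale [OF F3])
    finally show "F (f (?\<theta> i)) (?\<theta> i) = ?r i" .
  qed simp
  also have "\<dots> = (\<Sum>j\<in>?I. \<Sum>i\<in>?I. inner_biv (\<eta> j) (?\<theta> i) * F (f (?\<theta> i)) (\<eta> j))"
    by (subst sum.swap) (simp add: inner_biv_def inner_commute)
  also have "\<dots> = (\<Sum>j\<in>?I. F (f (\<eta> j)) (\<eta> j))"
    (is "(\<Sum>j\<in>_. ?s j) = _")
  proof (rule sum.cong)
    fix j assume "j \<in> ?I"
    have "F (f (\<eta> j)) (\<eta> j)
        = F (f (\<Sum>i\<in>?I. inner_biv (\<eta> j) (?\<theta> i) *\<^sub>R ?\<theta> i)) (\<eta> j)"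
      using ordered_eigenbasis_expand [OF e' mem(1) [OF \<open>j \<in> ?I\<close>]] by simp
    also have "\<dots> = ?s j"
      by (simp add: linear_sum [OF Ff] linear_scale [OF Ff])
    finally show "?s j = F (f (\<eta> j)) (\<eta> j)" by simp
  qed simp
  finally show ?thesis
    unfolding Q_def Q' [OF e] Q' [OF e'] using mem by (simp add: fR)
qed

end

theory Submission
  imports Defs
begin

text \<open>
Fix an orthonormal basis \<open>e\<^sub>a\<close> in which \<open>h\<close> is diagonal with eigenvalues \<open>\<mu>\<^sub>a\<close>. Then
\<open>Q R h = \<Sum>\<^sub>a\<^sub>,\<^sub>b K\<^sub>a\<^sub>b (\<mu>\<^sub>a - \<mu>\<^sub>b)\<^sup>2\<close> with \<open>K\<^sub>a\<^sub>b\<close> the sectional curvatures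
(\<open>Q_frame\<close>), so the statement concerns a symmetric matrix with zero diagonal. Write \<open>n\<close> for the
dimension and \<open>k = 2 (n - 1) / 3\<close>.

For \<open>h = Ric\<close> the \<open>\<mu>\<^sub>a\<close> are the row sums of \<open>K\<close>, and \<open>k\<close>-nonnegativity enters only through
a threshold \<open>t \<ge> 0\<close> such that the total amount by which the entries \<open>K\<^sub>a\<^sub>b\<close> (\<open>a < b\<close>) fall
below \<open>t\<close> is at most \<open>k t\<close> (\<open>k_nonnegative_threshold\<close>). Let \<open>i1\<close> and \<open>i2\<close> be the indices of
the largest and the smallest Ricci eigenvalue, rescale \<open>\<mu>\<close> affinely to \<open>s\<close> with \<open>s i1 = 0\<close> and
\<open>s i2 = 1\<close>, and let \<open>D = \<Sum>\<^bsub>a<b\<^esub> (s\<^sub>a - s\<^sub>b)\<^sup>2\<close> be the spread of \<open>s\<close>. If \<open>D \<ge> k\<close>,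
positivity is immediate. Otherwise put \<open>\<theta> = 1 - D / k\<close>. For every \<open>c\<close> with \<open>\<Sum> c\<^sub>a = 0\<close> and
\<open>\<Sum> c\<^sub>a s\<^sub>a = 0\<close> the row-sum relation gives \<open>\<Sum> c\<^sub>a \<mu>\<^sub>a = 0\<close>, so the squares
\<open>(s\<^sub>a - s\<^sub>b)\<^sup>2\<close> may be replaced by the weights \<open>w\<^sub>a\<^sub>b = (s\<^sub>a - s\<^sub>b)\<^sup>2 - c\<^sub>a - c\<^sub>b\<close> without
changing the weighted sum of curvatures. It suffices that \<open>w \<le> 1 - \<theta> = D / k\<close> and that \<open>w\<close> is
nonnegative on average against the excess \<open>q = max 0 (K - t)\<close>
(\<open>curvature_sum_nonneg_certificate\<close>). The choice is
\<open>c = \<theta> ((1 - m) 1\<^bsub>i1\<^esub> + m 1\<^bsub>i2\<^esub> - u)\<close>, where \<open>u\<close> is the excess of row \<open>i1\<close> away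
from \<open>i2\<close>, normalised to total mass \<open>1\<close>, \<open>m\<close> is the mean of \<open>s\<close> under \<open>u\<close>, and
\<open>\<rho> = \<Sum> u\<^sub>j\<^sup>2\<close>. The upper bounds on \<open>w\<close> follow from \<open>\<theta> \<le> s\<^sub>j (1 - s\<^sub>j)\<close>. The average over row \<open>i1\<close> is nonnegative as soon as
\<open>\<theta> (1 - m - \<rho>) \<le> m\<^sup>2\<close>, and because
\<open>D \<ge> n / 2 + n (1 - 2 m)\<^sup>2 / (2 (1 + 2 \<rho>))\<close> (\<open>spread_ge_mean\<close>) this is an inequality in
\<open>n\<close>, \<open>m\<close>, \<open>\<rho>\<close>. The Cauchy-Schwarz inequality removes \<open>\<rho>\<close> and leaves a quadratic in \<open>m\<close> whose
discriminant is nonpositive up to \<open>n = 341\<close> (\<open>interpolation_real\<close>): this is the origin of the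
bound. The weights of row \<open>i2\<close> can be negative, but if they are, then exchanging \<open>i1\<close> and \<open>i2\<close>
gives a choice for which they are not; otherwise \<open>s\<close> would be too spread out
(\<open>spread_ge_two_gaps\<close>).

The counterexamples multiply the entries of a skew matrix by a symmetric matrix \<open>\<kappa>\<close>, so that
\<open>\<kappa>\<close> is the matrix of sectional curvatures. Taking \<open>\<kappa> = 1 - k\<close> at one pair and \<open>\<kappa> \<ge> 1\<close>
elsewhere makes the operator \<open>k\<close>-nonnegative (\<open>k_nonnegative_hadamard\<close>). With \<open>\<kappa> = 1\<close> elsewhere
and \<open>h = diag (1, -1, 0, \<dots>, 0)\<close> on that pair one gets \<open>Q = 4 n - 8 k\<close>, negative exactly for
\<open>n > 4\<close>. For \<open>h = Ric\<close> the equality case of the Cauchy-Schwarz argument is approximated: the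
mass \<open>u\<close> is equidistributed over 14 indices (\<open>\<rho> = 1 / 14\<close>), and the result is negative from
\<open>n = 342\<close> on.
\<close>

section \<open>The numerical inequality behind the bound 341\<close>

text \<open>
With \<open>x = 1 + 2 \<rho>\<close> and \<open>y = 1 - a - \<rho>\<close> the combination \<open>x + 2 y\<close> does not depend on \<open>\<rho>\<close>, so
\<open>p\<^sup>2 / x + q\<^sup>2 / (2 y) \<ge> (p + q)\<^sup>2 / (x + 2 y)\<close> eliminates \<open>\<rho>\<close> without loss. For fixed
\<open>x, y, a\<close> the claim is affine in \<open>n\<close>. If \<open>a\<^sup>2 > y\<close>, its left-hand side is nonpositive;
otherwise it is trivial at \<open>n = 0\<close>, so only \<open>n = 341\<close> has to be examined.
\<close>

lemma interpolation_real:
  fixes a x y n k :: real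
  assumes x: "x > 0" and y: "y > 0" and xy: "x + 2 * y = 3 - 2 * a"
    and n: "1 \<le> n" "n \<le> 341" and k: "k = 2 * (n - 1) / 3"
  shows "k * (1 - a\<^sup>2 / y) \<le> n / 2 + n * (1 - 2 * a)\<^sup>2 / (2 * x)"
proof -
  define h where "h = a\<^sup>2 / y"
  define g where "g = (1 - 2 * a)\<^sup>2 / x"
  have g0: "g \<ge> 0"
    using x by (simp add: g_def)
  \<comment> \<open>This is \<open>c\<^sup>2 = 4 k / n\<close> at \<open>n = 341\<close>, where \<open>k = 680 / 3\<close>.\<close>
  define c :: real where "c = sqrt (2720 / 1023)"
  have c2: "c\<^sup>2 = 2720 / 1023" and c0: "c > 0"
    by (auto simp: c_def)
  \<comment> \<open>The larger root of \<open>7 c\<^sup>2 - 20 c + 14\<close> is \<open>(10 + sqrt 2) / 7\<close>; it exceeds \<open>c\<close>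
    only slightly, and with 342 in place of 341 it would not.\<close>
  have c_low: "7 * c\<^sup>2 + 14 \<le> 20 * c"
  proof (rule power2_le_imp_le)
    have "(7 * c\<^sup>2 + 14)\<^sup>2 \<le> 400 * c\<^sup>2"
      unfolding c2 by (simp add: power2_eq_square)
    then show "(7 * c\<^sup>2 + 14)\<^sup>2 \<le> (20 * c)\<^sup>2"
      by (simp add: power_mult_distrib)
  qed (use c0 in auto)
  have cauchy: "(1 + (c - 2) * a)\<^sup>2 \<le> (g + c\<^sup>2 * h / 2) * (3 - 2 * a)"
  proof -
    let ?p = "1 - 2 * a" and ?q = "c * a"
    have "(g + c\<^sup>2 * h / 2) * (x + 2 * y) - (?p + ?q)\<^sup>2
       = (2 * y * ?p - x * ?q)\<^sup>2 / (2 * x * y)"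
      using x y unfolding g_def h_def by (simp add: field_simps power2_eq_square)
    moreover have "(2 * y * ?p - x * ?q)\<^sup>2 / (2 * x * y) \<ge> 0"
      using x y by simp
    ultimately show ?thesis
      unfolding xy by (simp add: algebra_simps)
  qed
  \<comment> \<open>A quadratic in \<open>a\<close> with discriminant \<open>\<kappa> (7 c\<^sup>2 - 20 c + 14) / 2\<close> up to a positive factor.\<close>
  have quad: "(c\<^sup>2 / 2 - 1) * (3 - 2 * a) \<le> (1 + (c - 2) * a)\<^sup>2"
  proof -
    define \<beta> where "\<beta> = c - 2"
    define \<kappa> where "\<kappa> = c\<^sup>2 / 2 - 1"
    have \<kappa>: "\<kappa> > 0" by (simp add: \<kappa>_def c2)
    have "\<kappa> * (\<kappa> + 2 * \<beta> + 3 * \<beta>\<^sup>2) = \<kappa> * ((7 * c\<^sup>2 + 14 - 20 * c) / 2)"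
      by (simp add: \<kappa>_def \<beta>_def power2_eq_square field_simps)
    also have "\<dots> \<le> 0"
      using \<kappa> c_low by (intro mult_nonneg_nonpos) auto
    finally have disc: "\<kappa> * (\<kappa> + 2 * \<beta> + 3 * \<beta>\<^sup>2) \<le> 0" .
    have "c \<noteq> 2" using c2 by auto
    then have b2: "\<beta>\<^sup>2 > 0" by (simp add: \<beta>_def)
    have "\<beta>\<^sup>2 * ((1 + \<beta> * a)\<^sup>2 - \<kappa> * (3 - 2 * a))
        = (\<beta>\<^sup>2 * a + (\<beta> + \<kappa>))\<^sup>2 - \<kappa> * (\<kappa> + 2 * \<beta> + 3 * \<beta>\<^sup>2)"
      by (simp add: power2_eq_square algebra_simps)
    also have "\<dots> \<ge> 0" using disc by (smt (verit) zero_le_power2)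
    finally have "(1 + \<beta> * a)\<^sup>2 - \<kappa> * (3 - 2 * a) \<ge> 0"
      using b2 by (simp add: zero_le_mult_iff)
    then show ?thesis by (simp add: \<kappa>_def \<beta>_def)
  qed
  have pos: "3 - 2 * a > 0" using x y xy by simp
  have "c\<^sup>2 / 2 - 1 \<le> g + c\<^sup>2 * h / 2"
    using order_trans [OF quad cauchy] pos by simp
  then have top: "680 / 3 * (1 - h) \<le> 341 / 2 + 341 / 2 * g"
    unfolding c2 by simp
  have "k * (1 - h) \<le> n / 2 + n / 2 * g"
  proof (cases "h \<le> 1")
    case True
    have e: "n / 2 + n / 2 * g - k * (1 - h)
       = n / 341 * (341 / 2 + 341 / 2 * g - 680 / 3 * (1 - h)) + (1 - n / 341) * (2 / 3 * (1 - h))"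
      unfolding k by (simp add: field_simps)
    have "n / 341 * (341 / 2 + 341 / 2 * g - 680 / 3 * (1 - h)) \<ge> 0"
      using n top by (intro mult_nonneg_nonneg) auto
    moreover have "(1 - n / 341) * (2 / 3 * (1 - h)) \<ge> 0"
      using n True by (intro mult_nonneg_nonneg) auto
    ultimately show ?thesis using e by linarith
  next
    case False
    then have "k * (1 - h) \<le> 0" using n unfolding k by (intro mult_nonneg_nonpos) auto
    moreover have "n / 2 * g \<ge> 0" using n g0 by simp
    ultimately show ?thesis using n by linarith
  qed
  then show ?thesis by (simp add: h_def g_def)
qed


section \<open>Lower bounds for the spread of a sequence\<close>

definition spread :: "('n::finite \<Rightarrow> real) \<Rightarrow> real" where
  "spread s = (\<Sum>a\<in>UNIV. \<Sum>b\<in>UNIV. (s a - s b)\<^sup>2) / 2"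

lemma spread_eq:
  fixes s :: "'n::finite \<Rightarrow> real"
  shows "spread s = CARD('n) * (\<Sum>a\<in>UNIV. (s a)\<^sup>2) - (\<Sum>a\<in>UNIV. s a)\<^sup>2"
proof -
  have "(\<Sum>a\<in>UNIV. \<Sum>b\<in>UNIV. (s a - s b)\<^sup>2)
     = (\<Sum>a\<in>UNIV. \<Sum>b\<in>(UNIV::'n set). (s a)\<^sup>2) + (\<Sum>a\<in>(UNIV::'n set). \<Sum>b\<in>(UNIV::'n set). (s b)\<^sup>2)
       - 2 * (\<Sum>a\<in>UNIV. \<Sum>b\<in>UNIV. s a * s b)"
    by (simp only: power2_diff sum.distrib sum_subtractf sum_distrib_left mult.assoc)
  also have "(\<Sum>a\<in>UNIV. \<Sum>b\<in>UNIV. s a * s b) = (\<Sum>a\<in>UNIV. s a)\<^sup>2"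
    by (simp add: power2_eq_square sum_product)
  finally show ?thesis
    by (simp add: spread_def sum_distrib_left [symmetric])
qed

lemma spread_shift: "spread (\<lambda>a. s a - c) = spread s"
  by (simp add: spread_def)

lemma spread_reflect: "spread (\<lambda>a. 1 - s a) = spread s"
  by (simp add: spread_def power2_commute)

text \<open>
Apart from the two entries \<open>0\<close> and \<open>1\<close>, the spread minus \<open>n / 2\<close> is a positive definite quadratic
form in \<open>s - 1 / 2\<close>, namely \<open>n |t|\<^sup>2 - (\<Sum> t)\<^sup>2\<close> on \<open>n - 2\<close> entries. Its inverse is
\<open>(I + J / 2) / n\<close> with \<open>J\<close> the all-ones matrix, and the bound is the Legendre dual of the form evaluated at a multiple of \<open>v\<close>.
\<close>

lemma spread_ge_test:
  fixes s v :: "'n::finite \<Rightarrow> real"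
  assumes i: "i1 \<noteq> i2" "s i1 = 0" "s i2 = 1" and v: "v i1 = 0" "v i2 = 0"
    and n: "3 \<le> CARD('n)"
  shows "CARD('n) * (1 / 2 + 2 * (\<Sum>a\<in>UNIV. v a * (s a - 1 / 2)) - (\<Sum>a\<in>UNIV. (v a)\<^sup>2)
           - (\<Sum>a\<in>UNIV. v a)\<^sup>2 / 2) \<le> spread s"
proof -
  define J where "J = UNIV - {i1, i2}"
  define t where "t = (\<lambda>a. s a - 1 / 2)"
  define n where "n = real CARD('n)"
  have split: "(\<Sum>a\<in>UNIV. f a) = f i1 + f i2 + (\<Sum>a\<in>J. f a)" for f :: "'n \<Rightarrow> real"
  proof -
    have "(\<Sum>a\<in>UNIV. f a) = (\<Sum>a\<in>{i1, i2}. f a) + (\<Sum>a\<in>J. f a)"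
      unfolding J_def by (subst sum.subset_diff [of "{i1, i2}"]) (auto simp: add.commute)
    then show ?thesis using i by simp
  qed
  have cardJ: "real (card J) = n - 2" "n \<ge> 3"
    using i(1) n by (simp_all add: J_def n_def card_Diff_subset of_nat_diff)
  define T where "T = sum t J"
  define V where "V = sum v J"
  define x where "x = (\<lambda>a. t a - v a)"
  have "(sum x J)\<^sup>2 \<le> (\<Sum>a\<in>J. (x a)\<^sup>2) * card J"
    by (rule sum_squared_le_sum_of_squares)
  moreover have "sum x J = T - V"
    by (simp add: x_def T_def V_def sum_subtractf)
  ultimately have cs: "(T - V)\<^sup>2 \<le> (\<Sum>a\<in>J. (x a)\<^sup>2) * (n - 2)"
    by (simp add: cardJ)
  have x2: "(\<Sum>a\<in>J. (x a)\<^sup>2) = (\<Sum>a\<in>J. (t a)\<^sup>2) - 2 * (\<Sum>a\<in>J. v a * t a) + (\<Sum>a\<in>J. (v a)\<^sup>2)"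
    by (simp add: x_def power2_diff sum.distrib sum_subtractf sum_distrib_left mult_ac)
  have "spread s = spread t"
    unfolding t_def by (simp add: spread_shift)
  also have "\<dots> = n * (1 / 2 + (\<Sum>a\<in>J. (t a)\<^sup>2)) - T\<^sup>2"
  proof -
    have ti: "t i1 = - 1 / 2" "t i2 = 1 / 2" using i by (simp_all add: t_def)
    show ?thesis
      unfolding spread_eq split ti by (simp add: n_def T_def power2_eq_square)
  qed
  finally have D: "spread s = n * (1 / 2 + (\<Sum>a\<in>J. (t a)\<^sup>2)) - T\<^sup>2" .
  have "0 \<le> n * (\<Sum>a\<in>J. (x a)\<^sup>2) - T\<^sup>2 + n * V\<^sup>2 / 2"
  proof -
    have "(n - 2) * (n * (\<Sum>a\<in>J. (x a)\<^sup>2) - T\<^sup>2 + n * V\<^sup>2 / 2)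
        = n * ((\<Sum>a\<in>J. (x a)\<^sup>2) * (n - 2) - (T - V)\<^sup>2) + 2 * (T - n * V / 2)\<^sup>2"
      by (simp add: power2_eq_square field_simps)
    also have "\<dots> \<ge> 0"
      using cs cardJ by (intro add_nonneg_nonneg mult_nonneg_nonneg) auto
    finally show ?thesis using cardJ by (simp add: zero_le_mult_iff)
  qed
  then show ?thesis
    unfolding D x2 using v by (simp add: split V_def t_def n_def [symmetric] algebra_simps)
qed

text \<open>
The test vector is the multiple of \<open>u\<close> that optimises the dual bound.
\<close>

lemma spread_ge_mean:
  fixes s u :: "'n::finite \<Rightarrow> real" and \<mu> \<rho> :: real
  assumes i: "i1 \<noteq> i2" "s i1 = 0" "s i2 = 1" and u: "u i1 = 0" "u i2 = 0" "(\<Sum>a\<in>UNIV. u a) = 1"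
    and n: "3 \<le> CARD('n)"
  defines "\<mu> \<equiv> \<Sum>a\<in>UNIV. u a * s a" and "\<rho> \<equiv> \<Sum>a\<in>UNIV. (u a)\<^sup>2"
  shows "CARD('n) / 2 + CARD('n) * (1 - 2 * \<mu>)\<^sup>2 / (2 * (1 + 2 * \<rho>)) \<le> spread s"
proof -
  define \<xi> where "\<xi> = (2 * \<mu> - 1) / (1 + 2 * \<rho>)"
  have \<rho>: "\<rho> \<ge> 0" by (simp add: \<rho>_def sum_nonneg)
  have mean: "(\<Sum>a\<in>UNIV. u a * (s a - 1 / 2)) = \<mu> - 1 / 2"
    using u(3) by (simp add: right_diff_distrib sum_subtractf \<mu>_def sum_divide_distrib [symmetric])
  have "CARD('n) * (1 / 2 + 2 * (\<Sum>a\<in>UNIV. \<xi> * u a * (s a - 1 / 2)) - (\<Sum>a\<in>UNIV. (\<xi> * u a)\<^sup>2)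
           - (\<Sum>a\<in>UNIV. \<xi> * u a)\<^sup>2 / 2) \<le> spread s"
    using u by (intro spread_ge_test [OF i _ _ n]) auto
  also have "(\<Sum>a\<in>UNIV. \<xi> * u a * (s a - 1 / 2)) = \<xi> * (\<mu> - 1 / 2)"
    by (simp add: mult.assoc sum_distrib_left [symmetric] mean)
  also have "(\<Sum>a\<in>UNIV. (\<xi> * u a)\<^sup>2) = \<xi>\<^sup>2 * \<rho>"
    by (simp add: power_mult_distrib sum_distrib_left [symmetric] \<rho>_def)
  also have "(\<Sum>a\<in>UNIV. \<xi> * u a) = \<xi>"
    by (simp add: sum_distrib_left [symmetric] u)
  also have "1 / 2 + 2 * (\<xi> * (\<mu> - 1 / 2)) - \<xi>\<^sup>2 * \<rho> - \<xi>\<^sup>2 / 2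
      = 1 / 2 + (1 - 2 * \<mu>)\<^sup>2 / (2 * (1 + 2 * \<rho>))"
  proof -
    have "1 + 2 * \<rho> \<noteq> 0" using \<rho> by simp
    then have \<xi>: "(1 + 2 * \<rho>) * \<xi> = 2 * \<mu> - 1" by (simp add: \<xi>_def)
    have "(1 - 2 * \<mu>)\<^sup>2 / (2 * (1 + 2 * \<rho>)) = \<xi> * (2 * \<mu> - 1) / 2"
      using \<open>1 + 2 * \<rho> \<noteq> 0\<close> by (simp add: \<xi>_def power2_eq_square field_simps)
    moreover have "\<xi>\<^sup>2 * \<rho> + \<xi>\<^sup>2 / 2 = \<xi> * ((1 + 2 * \<rho>) * \<xi>) / 2"
      by (simp add: power2_eq_square algebra_simps)
    ultimately show ?thesis unfolding \<xi> by (simp add: algebra_simps)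
  qed
  finally show ?thesis by (simp add: algebra_simps)
qed

lemma spread_ge_entry:
  fixes s :: "'n::finite \<Rightarrow> real"
  assumes i: "i1 \<noteq> i2" "s i1 = 0" "s i2 = 1" and n: "3 \<le> CARD('n)"
    and j: "j \<notin> {i1, i2}"
  shows "CARD('n) / 2 + CARD('n) * (1 - 2 * s j)\<^sup>2 / 6 \<le> spread s"
proof -
  have e: "(\<Sum>a\<in>UNIV. (if a = j then 1 else 0) * f a) = f j" for f :: "'n \<Rightarrow> real"
    by (simp add: if_distrib [of "\<lambda>x. x * _"] cong: if_cong)
  have "(\<Sum>a\<in>UNIV. (if a = j then 1 else 0)\<^sup>2) = (1::real)"
    by (simp add: if_distrib [of "\<lambda>x. x ^ 2"] cong: if_cong)
  with spread_ge_mean [OF i, of "\<lambda>a. if a = j then 1 else 0"] j n e [of s] show ?thesis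
    by auto
qed

text \<open>
The test vector is \<open>\<alpha> (1\<^sub>j - 1\<^sub>i) + \<beta> (1\<^sub>l - 1\<^bsub>l'\<^esub>)\<close>. It has total mass \<open>0\<close>, and the
hypotheses \<open>l \<noteq> j\<close> and \<open>l' \<noteq> i\<close> make the cross term of its square nonpositive, so other
coincidences among the four indices do no harm.
\<close>

lemma spread_ge_two_gaps:
  fixes s :: "'n::finite \<Rightarrow> real"
  assumes i: "i1 \<noteq> i2" "s i1 = 0" "s i2 = 1" and n: "3 \<le> CARD('n)"
    and J: "i \<notin> {i1, i2}" "j \<notin> {i1, i2}" "l \<notin> {i1, i2}" "l' \<notin> {i1, i2}"
    and ne: "l \<noteq> j" "l' \<noteq> i" and pos: "\<alpha> \<ge> 0" "\<beta> \<ge> 0"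
  shows "CARD('n) * (1 / 2 + 2 * \<alpha> * (s j - s i) + 2 * \<beta> * (s l - s l')
           - 2 * \<alpha>\<^sup>2 - 2 * \<beta>\<^sup>2) \<le> spread s"
proof -
  define d where "d = (\<lambda>b a :: 'n. if a = b then 1 else 0 :: real)"
  define v where "v = (\<lambda>a. \<alpha> * (d j a - d i a) + \<beta> * (d l a - d l' a))"
  have dsum: "(\<Sum>a\<in>UNIV. d b a * f a) = f b" for f b
    by (simp add: d_def if_distrib [of "\<lambda>x. x * _"] cong: if_cong)
  have dd: "(\<Sum>a\<in>UNIV. d b a * d c a) = d b c" for b c by (simp add: dsum) (simp add: d_def)
  have d1: "(\<Sum>a\<in>UNIV. d b a) = 1" for b using dsum [of b "\<lambda>_. 1"] by simp
  have sv: "(\<Sum>a\<in>UNIV. v a) = 0"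
    unfolding v_def by (simp add: sum.distrib sum_subtractf sum_distrib_left [symmetric] d1)
  have lin: "(\<Sum>a\<in>UNIV. v a * (s a - 1 / 2)) = \<alpha> * (s j - s i) + \<beta> * (s l - s l')"
  proof -
    have "(\<Sum>a\<in>UNIV. v a * (s a - 1 / 2))
      = \<alpha> * ((\<Sum>a\<in>UNIV. d j a * (s a - 1/2)) - (\<Sum>a\<in>UNIV. d i a * (s a - 1/2)))
      + \<beta> * ((\<Sum>a\<in>UNIV. d l a * (s a - 1/2)) - (\<Sum>a\<in>UNIV. d l' a * (s a - 1/2)))"
      unfolding sum_subtractf [symmetric] sum_distrib_left sum.distrib [symmetric]
      by (rule sum.cong) (auto simp: v_def algebra_simps)
    then show ?thesis unfolding dsum by simp
  qed
  have sq: "(\<Sum>a\<in>UNIV. (v a)\<^sup>2) \<le> 2 * \<alpha>\<^sup>2 + 2 * \<beta>\<^sup>2"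
  proof -
    have "(\<Sum>a\<in>UNIV. (v a)\<^sup>2) =
       \<alpha>\<^sup>2 * ((\<Sum>a\<in>UNIV. d j a * d j a) - 2 * (\<Sum>a\<in>UNIV. d j a * d i a) + (\<Sum>a\<in>UNIV. d i a * d i a))
     + \<beta>\<^sup>2 * ((\<Sum>a\<in>UNIV. d l a * d l a) - 2 * (\<Sum>a\<in>UNIV. d l a * d l' a) + (\<Sum>a\<in>UNIV. d l' a * d l' a))
     + 2 * (\<alpha> * \<beta>) * ((\<Sum>a\<in>UNIV. d j a * d l a) - (\<Sum>a\<in>UNIV. d j a * d l' a)
         - (\<Sum>a\<in>UNIV. d i a * d l a) + (\<Sum>a\<in>UNIV. d i a * d l' a))"
      unfolding sum_subtractf [symmetric] sum_distrib_left sum.distrib [symmetric]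
      by (rule sum.cong) (auto simp: v_def power2_eq_square algebra_simps)
    also have "\<dots> = \<alpha>\<^sup>2 * (2 - 2 * d j i) + \<beta>\<^sup>2 * (2 - 2 * d l l') - 2 * (\<alpha> * \<beta>) * (d j l' + d i l)"
      unfolding dd using ne by (simp add: d_def)
    also have "\<dots> \<le> \<alpha>\<^sup>2 * 2 + \<beta>\<^sup>2 * 2 - 2 * 0"
    proof (intro add_mono diff_mono mult_left_mono)
      show "2 * 0 \<le> 2 * (\<alpha> * \<beta>) * (d j l' + d i l)" using pos by (simp add: d_def)
    qed (auto simp: d_def)
    finally show ?thesis by simp
  qed
  have "CARD('n) * (1 / 2 + 2 * (\<Sum>a\<in>UNIV. v a * (s a - 1 / 2)) - (\<Sum>a\<in>UNIV. (v a)\<^sup>2)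
           - (\<Sum>a\<in>UNIV. v a)\<^sup>2 / 2) \<le> spread s"
    using J by (intro spread_ge_test [OF i _ _ n]) (auto simp: v_def d_def)
  moreover have "CARD('n) * (1 / 2 + 2 * \<alpha> * (s j - s i) + 2 * \<beta> * (s l - s l')
      - 2 * \<alpha>\<^sup>2 - 2 * \<beta>\<^sup>2) \<le> CARD('n) * (1 / 2 + 2 * (\<Sum>a\<in>UNIV. v a * (s a - 1 / 2))
      - (\<Sum>a\<in>UNIV. (v a)\<^sup>2) - (\<Sum>a\<in>UNIV. v a)\<^sup>2 / 2)"
    using sq by (intro mult_left_mono) (auto simp: lin sv)
  ultimately show ?thesis by linarith
qed


section \<open>Weights certifying nonnegativity of the curvature sum\<close>

lemma sum_offdiag_swap:
  fixes f :: "'n::finite \<Rightarrow> 'n \<Rightarrow> real"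
  shows "(\<Sum>a\<in>UNIV. \<Sum>b\<in>-{a}. f a b) = (\<Sum>a\<in>UNIV. \<Sum>b\<in>-{a}. f b a)"
  by (simp add: Compl_eq_Diff_UNIV sum_diff1 sum_subtractf sum.swap [of f])

text \<open>
The part of the weights given by \<open>c\<close> is invisible to \<open>K\<close>, by the orthogonality of \<open>c\<close> to the row
sums. Splitting \<open>K = t + max 0 (K - t) - max 0 (t - K)\<close>, the first part contributes \<open>2 t\<close> times
the spread, which pays for the deficit \<open>max 0 (t - K)\<close> weighted by at most \<open>\<sigma>\<close>.
\<close>

lemma curvature_sum_nonneg_certificate:
  fixes K :: "'n::finite \<Rightarrow> 'n \<Rightarrow> real" and s c :: "'n \<Rightarrow> real"
  assumes sym: "\<And>a b. K a b = K b a"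
    and t: "t \<ge> 0" "(\<Sum>a\<in>UNIV. \<Sum>b\<in>-{a}. max 0 (t - K a b)) \<le> 2 * k * t"
    and c: "(\<Sum>a\<in>UNIV. c a) = 0" "(\<Sum>a\<in>UNIV. c a * (\<Sum>b\<in>-{a}. K a b)) = 0"
    and \<sigma>: "\<sigma> \<ge> 0" "\<sigma> * k \<le> spread s"
    and w: "\<And>a b. a \<noteq> b \<Longrightarrow> (s a - s b)\<^sup>2 - c a - c b \<le> \<sigma>"
    and q: "0 \<le> (\<Sum>a\<in>UNIV. \<Sum>b\<in>-{a}. max 0 (K a b - t) * ((s a - s b)\<^sup>2 - c a - c b))"
  shows "0 \<le> (\<Sum>a\<in>UNIV. \<Sum>b\<in>-{a}. K a b * (s a - s b)\<^sup>2)"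
proof -
  define W where "W = (\<lambda>a b. (s a - s b)\<^sup>2 - c a - c b)"
  have Kc: "(\<Sum>a\<in>UNIV. \<Sum>b\<in>-{a}. K a b * c a) = 0"
    using c(2) by (simp add: sum_distrib_left mult.commute)
  have Kc': "(\<Sum>a\<in>UNIV. \<Sum>b\<in>-{a}. K a b * c b) = 0"
    using Kc by (subst sum_offdiag_swap) (simp add: sym)
  have W1: "(\<Sum>a\<in>UNIV. \<Sum>b\<in>-{a}. K a b * (s a - s b)\<^sup>2) = (\<Sum>a\<in>UNIV. \<Sum>b\<in>-{a}. K a b * W a b)"
    using Kc Kc' by (simp add: W_def right_diff_distrib sum_subtractf)
  have cn: "(\<Sum>a\<in>UNIV. \<Sum>b\<in>-{a}. c a) = 0"
  proof -
    have "card (- {a}) = CARD('n) - 1" for a :: 'n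
      by (simp add: Compl_eq_Diff_UNIV card_Diff_singleton)
    then show ?thesis using c(1) by (simp add: sum_distrib_left [symmetric])
  qed
  have cn': "(\<Sum>a\<in>UNIV. \<Sum>b\<in>-{a}. c b) = 0"
    using cn by (subst sum_offdiag_swap)
  have "(\<Sum>a\<in>UNIV. \<Sum>b\<in>-{a}. (s a - s b)\<^sup>2) = 2 * spread s"
    by (simp add: spread_def Compl_eq_Diff_UNIV sum_diff1)
  then have W2: "(\<Sum>a\<in>UNIV. \<Sum>b\<in>-{a}. W a b) = 2 * spread s"
    using cn cn' by (simp add: W_def sum_subtractf)
  have "t * (2 * spread s) + 0 - \<sigma> * (2 * k * t)
    \<le> t * (\<Sum>a\<in>UNIV. \<Sum>b\<in>-{a}. W a b) + (\<Sum>a\<in>UNIV. \<Sum>b\<in>-{a}. max 0 (K a b - t) * W a b)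
       - \<sigma> * (\<Sum>a\<in>UNIV. \<Sum>b\<in>-{a}. max 0 (t - K a b))"
    unfolding W2 using q t \<sigma>(1) by (intro add_mono diff_mono mult_left_mono) (auto simp: W_def)
  also have "\<dots> = (\<Sum>a\<in>UNIV. \<Sum>b\<in>-{a}. t * W a b + max 0 (K a b - t) * W a b - \<sigma> * max 0 (t - K a b))"
    by (simp only: sum_distrib_left sum.distrib sum_subtractf)
  also have "\<dots> \<le> (\<Sum>a\<in>UNIV. \<Sum>b\<in>-{a}. K a b * W a b)"
  proof (intro sum_mono)
    fix a b :: 'n assume "b \<in> - {a}"
    then have "W a b \<le> \<sigma>" using w [of a b] by (auto simp: W_def)
    then have "max 0 (t - K a b) * W a b \<le> max 0 (t - K a b) * \<sigma>"
      by (intro mult_left_mono) auto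
    moreover have "K a b = t + max 0 (K a b - t) - max 0 (t - K a b)" by auto
    then have "K a b * W a b = t * W a b + max 0 (K a b - t) * W a b - max 0 (t - K a b) * W a b"
      by (metis left_diff_distrib distrib_right)
    ultimately show "t * W a b + max 0 (K a b - t) * W a b - \<sigma> * max 0 (t - K a b) \<le> K a b * W a b"
      by (simp add: mult.commute)
  qed
  finally have "t * (2 * spread s) - \<sigma> * (2 * k * t) \<le> (\<Sum>a\<in>UNIV. \<Sum>b\<in>-{a}. K a b * W a b)"
    by simp
  moreover have "t * (2 * spread s) - \<sigma> * (2 * k * t) = 2 * t * (spread s - \<sigma> * k)"
    by (simp add: algebra_simps)
  moreover have "\<dots> \<ge> 0" using t(1) \<sigma>(2) by simp
  ultimately show ?thesis unfolding W1 by linarith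
qed

text \<open>
Only the products \<open>q w\<close> over row \<open>i1\<close> can be negative, and there \<open>q = X u\<close>: their sum is
\<open>X (\<Sum> u s\<^sup>2 - \<theta> (1 - \<mu> - \<rho>))\<close>, where \<open>\<Sum> u s\<^sup>2 \<ge> \<mu>\<^sup>2\<close>. This is why \<open>u\<close> has to be
adapted to \<open>K\<close>. The last hypothesis says that the weights of row \<open>i2\<close> are nonnegative. The sign of
\<open>d\<close> is free, so that \<open>i1\<close> may be the index of the largest or of the smallest row sum.
\<close>

lemma curvature_sum_nonneg_weights:
  fixes K :: "'n::finite \<Rightarrow> 'n \<Rightarrow> real" and s u :: "'n \<Rightarrow> real" and \<mu> :: real
  assumes sym: "\<And>a b. K a b = K b a"
    and row: "\<And>a. (\<Sum>b\<in>-{a}. K a b) = M - d * s a"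
    and n: "3 \<le> CARD('n)" "CARD('n) \<le> 341" and k: "k = 2 * (real CARD('n) - 1) / 3"
    and t: "t \<ge> 0" "(\<Sum>a\<in>UNIV. \<Sum>b\<in>-{a}. max 0 (t - K a b)) \<le> 2 * k * t"
    and i: "i1 \<noteq> i2" "s i1 = 0" "s i2 = 1" and s: "\<And>a. 0 \<le> s a" "\<And>a. s a \<le> 1"
    and \<theta>: "0 \<le> \<theta>" "\<theta> \<le> 1" "spread s = (1 - \<theta>) * k"
    and \<theta>s: "\<And>j. j \<notin> {i1, i2} \<Longrightarrow> \<theta> \<le> s j * (1 - s j)"
    and u: "u i1 = 0" "u i2 = 0" "\<And>a. 0 \<le> u a" "(\<Sum>a\<in>UNIV. u a) = 1"
    and X: "X \<ge> 0" "\<And>j. j \<notin> {i1, i2} \<Longrightarrow> max 0 (K i1 j - t) = X * u j"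
  defines "\<mu> \<equiv> \<Sum>a\<in>UNIV. u a * s a"
  assumes dich: "\<And>j. j \<notin> {i1, i2} \<Longrightarrow> \<theta> * (\<mu> - u j) \<le> (1 - s j)\<^sup>2"
  shows "0 \<le> (\<Sum>a\<in>UNIV. \<Sum>b\<in>-{a}. K a b * (s a - s b)\<^sup>2)"
proof -
  define c where "c = (\<lambda>a. \<theta> * ((if a = i1 then 1 - \<mu> else 0) + (if a = i2 then \<mu> else 0) - u a))"
  define \<rho> where "\<rho> = (\<Sum>a\<in>UNIV. (u a)\<^sup>2)"
  have pair: "u a + u b \<le> 1" if "a \<noteq> b" for a b
  proof -
    have "u a + u b = (\<Sum>x\<in>{a, b}. u x)" using that by simp
    also have "\<dots> \<le> (\<Sum>x\<in>UNIV. u x)" using u by (intro sum_mono2) auto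
    finally show ?thesis using u by simp
  qed
  have u1: "u a \<le> 1" for a
    using pair [of a i1] pair [of a i2] u i by (cases "a = i1") auto
  have \<mu>01: "0 \<le> \<mu>" "\<mu> \<le> 1"
  proof -
    show "0 \<le> \<mu>" unfolding \<mu>_def using u s by (intro sum_nonneg) auto
    have "\<mu> \<le> (\<Sum>a\<in>UNIV. u a * 1)" unfolding \<mu>_def using u s by (intro sum_mono mult_left_mono) auto
    then show "\<mu> \<le> 1" using u by simp
  qed
  have ci: "c i1 = \<theta> * (1 - \<mu>)" "c i2 = \<theta> * \<mu>"
    using i u by (auto simp: c_def)
  have cj: "c j = - \<theta> * u j" if "j \<notin> {i1, i2}" for j
    using that by (auto simp: c_def)
  have csum: "(\<Sum>a\<in>UNIV. c a * f a) = \<theta> * ((1 - \<mu>) * f i1 + \<mu> * f i2 - (\<Sum>a\<in>UNIV. u a * f a))" for f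
  proof -
    have "(\<Sum>a\<in>UNIV. c a * f a) = \<theta> * (\<Sum>a\<in>UNIV. (if a = i1 then (1 - \<mu>) * f a else 0)
       + (if a = i2 then \<mu> * f a else 0) - u a * f a)"
      unfolding sum_distrib_left by (intro sum.cong) (auto simp: c_def algebra_simps)
    then show ?thesis by (simp add: sum.distrib sum_subtractf)
  qed
  have D: "CARD('n) / 2 + CARD('n) * (1 - 2 * \<mu>)\<^sup>2 / (2 * (1 + 2 * \<rho>)) \<le> spread s"
    unfolding \<mu>_def \<rho>_def using u by (intro spread_ge_mean [OF i _ _ _ n(1)]) auto
  have key: "\<theta> * (1 - \<mu> - \<rho>) \<le> \<mu>\<^sup>2"
  proof (cases "1 - \<mu> - \<rho> > 0")
    case False
    then have "\<theta> * (1 - \<mu> - \<rho>) \<le> 0" using \<theta> by (intro mult_nonneg_nonpos) auto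
    then show ?thesis using zero_le_power2 order_trans by blast
  next
    case True
    have "\<rho> \<ge> 0" by (simp add: \<rho>_def sum_nonneg)
    then have "k * (1 - \<mu>\<^sup>2 / (1 - \<mu> - \<rho>)) \<le> CARD('n) / 2 + CARD('n) * (1 - 2 * \<mu>)\<^sup>2 / (2 * (1 + 2 * \<rho>))"
      using True n k by (intro interpolation_real) auto
    also have "\<dots> \<le> k * (1 - \<theta>)" using D \<theta>(3) by (simp add: mult.commute)
    finally have "\<theta> \<le> \<mu>\<^sup>2 / (1 - \<mu> - \<rho>)" using n k by simp
    then show ?thesis using True by (simp add: field_simps)
  qed
  define w where "w = (\<lambda>a b. (s a - s b)\<^sup>2 - c a - c b)"
  have wsym: "w a b = w b a" for a b by (simp add: w_def power2_commute)
  have w12: "w i1 i2 = 1 - \<theta>" by (simp add: w_def i ci algebra_simps)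
  have w1: "w i1 j = (s j)\<^sup>2 - \<theta> * (1 - \<mu>) + \<theta> * u j" if "j \<notin> {i1, i2}" for j
    using that by (simp add: w_def i ci cj)
  have w2: "w i2 j = (1 - s j)\<^sup>2 - \<theta> * \<mu> + \<theta> * u j" if "j \<notin> {i1, i2}" for j
    using that by (simp add: w_def i ci cj)
  have wJ: "w a b = (s a - s b)\<^sup>2 + \<theta> * (u a + u b)" if "a \<notin> {i1, i2}" "b \<notin> {i1, i2}" for a b
    using that by (simp add: w_def cj algebra_simps)
  have bound: "\<theta> * x \<le> 2 * (s j * (1 - s j))" if "j \<notin> {i1, i2}" "0 \<le> x" "x \<le> 2" for j x
  proof -
    have "\<theta> * x \<le> (s j * (1 - s j)) * 2"
      using \<theta>s [OF that(1)] that \<theta> s by (intro mult_mono) auto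
    then show ?thesis by simp
  qed
  have w1_le: "w i1 j \<le> 1 - \<theta>" if "j \<notin> {i1, i2}" for j
  proof -
    have "\<theta> * (\<mu> + u j) \<le> 2 * (s j * (1 - s j))" using that \<mu>01 u u1 [of j] by (intro bound) auto
    also have "\<dots> = 1 - (s j)\<^sup>2 - (1 - s j)\<^sup>2" by (simp add: power2_eq_square algebra_simps)
    also have "\<dots> \<le> 1 - (s j)\<^sup>2" by simp
    finally show ?thesis unfolding w1 [OF that] by (simp add: algebra_simps)
  qed
  have w2_le: "w i2 j \<le> 1 - \<theta>" if "j \<notin> {i1, i2}" for j
  proof -
    have "\<theta> * (1 - \<mu> + u j) \<le> 2 * (s j * (1 - s j))" using that \<mu>01 u u1 [of j] by (intro bound) auto
    also have "\<dots> = 1 - (s j)\<^sup>2 - (1 - s j)\<^sup>2" by (simp add: power2_eq_square algebra_simps)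
    also have "\<dots> \<le> 1 - (1 - s j)\<^sup>2" by simp
    finally show ?thesis unfolding w2 [OF that] by (simp add: algebra_simps)
  qed
  have wJ_le: "w a b \<le> 1 - \<theta>" if "a \<notin> {i1, i2}" "b \<notin> {i1, i2}" "a \<noteq> b" for a b
  proof -
    have "\<theta> * (1 + u a + u b) \<le> 2 * (s a * (1 - s a))"
      using that u pair [of a b] by (intro bound) (auto simp: add_nonneg_nonneg)
    also have "\<dots> = 1 - (s a)\<^sup>2 - (1 - s a)\<^sup>2" by (simp add: power2_eq_square algebra_simps)
    also have "\<dots> \<le> 1 - (s a - s b)\<^sup>2"
    proof -
      have "\<bar>s a - s b\<bar> \<le> s a \<or> \<bar>s a - s b\<bar> \<le> 1 - s a"
        using s [of a] s [of b] by linarith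
      then have "(s a - s b)\<^sup>2 \<le> (s a)\<^sup>2 \<or> (s a - s b)\<^sup>2 \<le> (1 - s a)\<^sup>2"
        by (metis abs_ge_zero power2_abs power_mono)
      then show ?thesis using zero_le_power2 [of "s a"] zero_le_power2 [of "1 - s a"] by linarith
    qed
    finally show ?thesis unfolding wJ [OF that(1,2)] by (simp add: algebra_simps)
  qed
  have w_le: "w a b \<le> 1 - \<theta>" if "a \<noteq> b" for a b
    using that w12 w1_le w2_le wJ_le wsym
    by (metis empty_iff insert_iff order_refl)
  have w_pos: "w a b \<ge> 0" if "a \<noteq> i1" "b \<noteq> i1" "a \<noteq> b" for a b
  proof -
    have "w i2 j \<ge> 0" if "j \<notin> {i1, i2}" for j
      using dich [OF that] unfolding w2 [OF that] by (simp add: algebra_simps)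
    moreover have "w a b \<ge> 0" if "a \<notin> {i1, i2}" "b \<notin> {i1, i2}" for a b
      unfolding wJ [OF that] using \<theta> u by simp
    ultimately show ?thesis using that wsym by (metis empty_iff insert_iff)
  qed
  define f where "f = (\<lambda>a b. max 0 (K a b - t) * w a b)"
  have fsym: "f a b = f b a" for a b by (simp add: f_def sym wsym)
  have f_pos: "f a b \<ge> 0" if "a \<noteq> i1" "b \<noteq> i1" "a \<noteq> b" for a b
    using w_pos that by (simp add: f_def)
  have frow: "(\<Sum>b\<in>-{i1}. f i1 b) \<ge> 0"
  proof -
    have "(\<Sum>b\<in>-{i1}. f i1 b) = f i1 i2 + (\<Sum>b\<in>-{i1, i2}. f i1 b)"
    proof -
      have "- {i1, i2} = - {i1} - {i2}" by auto
      then show ?thesis using i by (simp add: sum.remove [of "- {i1}" i2])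
    qed
    moreover have "f i1 i2 \<ge> 0" using \<theta> by (simp add: f_def w12)
    moreover have "(\<Sum>b\<in>-{i1, i2}. f i1 b) \<ge> 0"
    proof -
      have "(\<Sum>b\<in>-{i1, i2}. f i1 b)
         = (\<Sum>b\<in>-{i1, i2}. X * (u b * (s b)\<^sup>2 - \<theta> * (1 - \<mu>) * u b + \<theta> * (u b)\<^sup>2))"
        by (intro sum.cong) (auto simp: f_def X w1 power2_eq_square algebra_simps)
      also have "\<dots> = (\<Sum>b\<in>UNIV. X * (u b * (s b)\<^sup>2 - \<theta> * (1 - \<mu>) * u b + \<theta> * (u b)\<^sup>2))"
        using u by (intro sum.mono_neutral_left) auto
      also have "\<dots> = X * ((\<Sum>b\<in>UNIV. u b * (s b)\<^sup>2) - \<theta> * (1 - \<mu>) * 1 + \<theta> * \<rho>)"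
        unfolding u(4) [symmetric] \<rho>_def
        by (simp only: sum_distrib_left [symmetric] sum.distrib sum_subtractf)
      also have "\<dots> \<ge> 0"
      proof (intro mult_nonneg_nonneg X)
        have "0 \<le> (\<Sum>b\<in>UNIV. u b * (s b - \<mu>)\<^sup>2)" using u by (intro sum_nonneg) auto
        also have "\<dots> = (\<Sum>b\<in>UNIV. u b * (s b)\<^sup>2) - 2 * \<mu> * (\<Sum>b\<in>UNIV. u b * s b) + \<mu>\<^sup>2 * (\<Sum>b\<in>UNIV. u b)"
          unfolding sum_distrib_left sum.distrib [symmetric] sum_subtractf [symmetric]
          by (intro sum.cong) (auto simp: power2_eq_square algebra_simps)
        also have "\<dots> = (\<Sum>b\<in>UNIV. u b * (s b)\<^sup>2) - \<mu>\<^sup>2"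
          unfolding \<mu>_def [symmetric] u(4) by (simp add: power2_eq_square)
        finally show "0 \<le> (\<Sum>b\<in>UNIV. u b * (s b)\<^sup>2) - \<theta> * (1 - \<mu>) * 1 + \<theta> * \<rho>"
          using key by (simp add: algebra_simps)
      qed
      finally show ?thesis .
    qed
    ultimately show ?thesis by simp
  qed
  have qsum: "0 \<le> (\<Sum>a\<in>UNIV. \<Sum>b\<in>-{a}. f a b)"
  proof -
    have "(\<Sum>a\<in>UNIV. \<Sum>b\<in>-{a}. f a b) = (\<Sum>b\<in>-{i1}. f i1 b) + (\<Sum>a\<in>-{i1}. \<Sum>b\<in>-{a}. f a b)"
      by (simp add: sum.remove [of UNIV i1] Compl_eq_Diff_UNIV)
    also have "(\<Sum>a\<in>-{i1}. \<Sum>b\<in>-{a}. f a b) = (\<Sum>a\<in>-{i1}. f a i1 + (\<Sum>b\<in>-{a}-{i1}. f a b))"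
      by (intro sum.cong) (auto simp: sum.remove)
    also have "\<dots> = (\<Sum>b\<in>-{i1}. f i1 b) + (\<Sum>a\<in>-{i1}. \<Sum>b\<in>-{a}-{i1}. f a b)"
      by (simp add: sum.distrib fsym)
    finally have "(\<Sum>a\<in>UNIV. \<Sum>b\<in>-{a}. f a b) = 2 * (\<Sum>b\<in>-{i1}. f i1 b) + (\<Sum>a\<in>-{i1}. \<Sum>b\<in>-{a}-{i1}. f a b)"
      by simp
    moreover have "(\<Sum>a\<in>-{i1}. \<Sum>b\<in>-{a}-{i1}. f a b) \<ge> 0"
      by (intro sum_nonneg f_pos) auto
    ultimately show ?thesis using frow by simp
  qed
  show ?thesis
  proof (rule curvature_sum_nonneg_certificate [OF sym t])
    show "(\<Sum>a\<in>UNIV. c a) = 0" using csum [of "\<lambda>_. 1"] u by simp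
    have "(\<Sum>a\<in>UNIV. u a * (M - d * s a)) = M - d * \<mu>"
      by (simp add: right_diff_distrib sum_subtractf \<mu>_def u sum_distrib_left [symmetric]
          sum_distrib_right [symmetric] mult.left_commute)
    then show "(\<Sum>a\<in>UNIV. c a * (\<Sum>b\<in>-{a}. K a b)) = 0"
      unfolding row csum using i by (simp add: algebra_simps)
    show "0 \<le> 1 - \<theta>" "(1 - \<theta>) * k \<le> spread s" using \<theta> by auto
    show "(s a - s b)\<^sup>2 - c a - c b \<le> 1 - \<theta>" if "a \<noteq> b" for a b
      using w_le [OF that] by (simp add: w_def)
    show "0 \<le> (\<Sum>a\<in>UNIV. \<Sum>b\<in>-{a}. max 0 (K a b - t) * ((s a - s b)\<^sup>2 - c a - c b))"
      using qsum by (simp add: f_def w_def)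
  qed
qed


section \<open>Matrices with large partial sums of their smallest entries\<close>

lemma weights_exist:
  fixes g :: "'n::finite \<Rightarrow> real"
  assumes "3 \<le> CARD('n)" and g: "\<And>j. 0 \<le> g j" 
  obtains u X where "u i1 = 0" "u i2 = 0" "\<And>a. 0 \<le> u a" "(\<Sum>a\<in>UNIV. u a) = 1"
    "0 \<le> X" "\<And>j. j \<notin> {i1, i2} \<Longrightarrow> g j = X * u j"
proof (cases "(\<Sum>j\<in>-{i1, i2}. g j) = 0")
  case True
  then have z: "g j = 0" if "j \<notin> {i1, i2}" for j
    using that g by (simp add: sum_nonneg_eq_0_iff)
  have "card {i1, i2} < CARD('n)" using assms(1) card_insert_le_m1 [of 2 "{i2}" i1] by simp
  then have "{i1, i2} \<noteq> UNIV" by auto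
  then obtain j0 where "j0 \<notin> {i1, i2}" by blast
  then show ?thesis
    using z by (intro that [of "\<lambda>a. if a = j0 then 1 else 0" 0]) auto
next
  case False
  define X where "X = (\<Sum>j\<in>-{i1, i2}. g j)"
  have X: "X > 0" using False g by (simp add: X_def sum_nonneg less_le)
  define u where "u = (\<lambda>a. if a \<in> {i1, i2} then 0 else g a / X)"
  have "(\<Sum>a\<in>UNIV. u a) = (\<Sum>a\<in>-{i1, i2}. g a / X)"
    unfolding u_def by (subst sum.mono_neutral_right [of UNIV "-{i1, i2}"]) auto
  also have "\<dots> = 1" using X by (simp add: sum_divide_distrib [symmetric] X_def)
  finally show ?thesis
    using X g by (intro that [of u X]) (auto simp: u_def)
qed

text \<open>
If \<open>\<theta> s\<^sub>l \<le> (1 - s\<^sub>j)\<^sup>2\<close> held for all \<open>l \<noteq> j\<close>, averaging it over \<open>u\<close> would contradict the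
last hypothesis; the entry at \<open>j\<close> contributes \<open>u\<^sub>j (s\<^sub>j - 1) \<le> 0\<close>.
\<close>

lemma exceeding_entry:
  fixes s u :: "'n::finite \<Rightarrow> real"
  assumes u: "u i1 = 0" "u i2 = 0" "\<And>a. 0 \<le> u a" "(\<Sum>a\<in>UNIV. u a) = 1"
    and s: "\<And>a. s a \<le> 1" and \<theta>: "0 \<le> \<theta>"
    and exc: "(1 - s j)\<^sup>2 < \<theta> * ((\<Sum>a\<in>UNIV. u a * s a) - u j)"
  obtains l where "l \<notin> {i1, i2}" "l \<noteq> j" "(1 - s j)\<^sup>2 < \<theta> * s l"
proof -
  have "\<exists>l. l \<notin> {i1, i2} \<and> l \<noteq> j \<and> (1 - s j)\<^sup>2 < \<theta> * s l"
  proof (rule ccontr)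
    assume "\<not> ?thesis"
    then have le: "\<theta> * s l \<le> (1 - s j)\<^sup>2" if "l \<notin> {i1, i2}" "l \<noteq> j" for l
      using that by force
    have "\<theta> * ((\<Sum>a\<in>UNIV. u a * s a) - u j) = (\<Sum>a\<in>UNIV-{j}. u a * (\<theta> * s a)) - \<theta> * (u j * (1 - s j))"
      by (simp add: sum.remove [of UNIV j] sum_distrib_left algebra_simps)
    also have "\<dots> \<le> (\<Sum>a\<in>UNIV-{j}. u a * (1 - s j)\<^sup>2) - 0"
    proof (intro diff_mono sum_mono)
      fix a assume "a \<in> UNIV - {j}"
      then show "u a * (\<theta> * s a) \<le> u a * (1 - s j)\<^sup>2"
        using u le [of a] by (cases "a \<in> {i1, i2}") (auto intro: mult_left_mono)
    qed (use u s \<theta> in auto)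
    also have "\<dots> = (1 - u j) * (1 - s j)\<^sup>2"
      using u(4) by (simp add: sum_distrib_right [symmetric] sum.remove [of UNIV j])
    also have "\<dots> \<le> 1 * (1 - s j)\<^sup>2" using u by (intro mult_right_mono) auto
    finally show False using exc by simp
  qed
  then show ?thesis using that by blast
qed

text \<open>
As a quadratic in \<open>S\<close> the difference of the two sides has leading coefficient \<open>A\<close> and linear
coefficient \<open>-1\<close>; completing the square leaves a polynomial in \<open>y\<close> that is visibly nonnegative.
\<close>

lemma two_gaps_real:
  fixes S y :: real
  assumes "0 \<le> y"
  shows "(1 / 4 - 3 / 4 * (S\<^sup>2 + y\<^sup>2)) * (1 + y) \<le> (1 - S)\<^sup>2 / 2"
proof -
  define A where "A = 5 / 4 + 3 / 4 * y"
  define f where "f = (1 - S)\<^sup>2 / 2 - (1 / 4 - 3 / 4 * (S\<^sup>2 + y\<^sup>2)) * (1 + y)"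
  have "4 * A * f = (2 * A * S - 1)\<^sup>2 + ((1 - y)\<^sup>2 + 11 * y\<^sup>2 + 24 * y ^ 3 + 9 * y ^ 4) / 4"
    by (simp add: f_def A_def power2_eq_square power3_eq_cube power4_eq_xxxx field_simps)
  also have "\<dots> \<ge> 0" using assms by (intro add_nonneg_nonneg) auto
  finally have "f \<ge> 0" using assms by (simp add: A_def zero_le_mult_iff)
  then show ?thesis by (simp add: f_def)
qed

text \<open>
The weights are tried with the roles of the largest and the smallest row sum in both orders. If both
fail, there are a high entry \<open>s\<^sub>j\<close> and a low entry \<open>s\<^sub>i\<close> that are large relative to \<open>\<theta>\<close>; but
gaps in \<open>s\<close> increase the spread and so make \<open>\<theta>\<close> small, and the two effects are incompatible.
\<close>

lemma curvature_sum_nonneg: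
  fixes K :: "'n::finite \<Rightarrow> 'n \<Rightarrow> real" and r :: "'n \<Rightarrow> real"
  assumes sym: "\<And>a b. K a b = K b a"
    and row: "\<And>a. (\<Sum>b\<in>-{a}. K a b) = r a"
    and n: "3 \<le> CARD('n)" "CARD('n) \<le> 341" and k: "k = 2 * (real CARD('n) - 1) / 3"
    and t: "t \<ge> 0" "(\<Sum>a\<in>UNIV. \<Sum>b\<in>-{a}. max 0 (t - K a b)) \<le> 2 * k * t"
  shows "0 \<le> (\<Sum>a\<in>UNIV. \<Sum>b\<in>-{a}. K a b * (r a - r b)\<^sup>2)"
proof -
  have "Max (range r) \<in> range r" "Min (range r) \<in> range r" by (auto intro: Max_in Min_in)
  then obtain i1 i2 where "r i1 = Max (range r)" "r i2 = Min (range r)" by (metis imageE)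
  then have i1: "r a \<le> r i1" and i2: "r i2 \<le> r a" for a by simp_all
  show ?thesis
  proof (cases "r i1 = r i2")
    case True
    then have "K a b * (r a - r b)\<^sup>2 = 0" for a b
      using i1 [of a] i1 [of b] i2 [of a] i2 [of b] by simp
    then show ?thesis by (simp only: sum.neutral_const order_refl)
  next
    case False
    define d where "d = r i1 - r i2"
    have d: "d > 0" using False i1 [of i2] by (simp add: d_def)
    define s where "s = (\<lambda>a. (r i1 - r a) / d)"
    have rs: "r a = r i1 - d * s a" for a using d by (simp add: s_def)
    have ne: "i1 \<noteq> i2" and s1: "s i1 = 0" and s2: "s i2 = 1"
      using False d by (auto simp: s_def d_def)
    have s01: "0 \<le> s a" "s a \<le> 1" for a
      using i1 [of a] i2 [of a] d by (auto simp: s_def d_def)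
    have "0 \<le> (\<Sum>a\<in>UNIV. \<Sum>b\<in>-{a}. K a b * (s a - s b)\<^sup>2)"
    proof (cases "k \<le> spread s")
      case True
      have "(s a - s b)\<^sup>2 \<le> 1" for a b
        using s01 [of a] s01 [of b] by (simp add: abs_square_le_1 abs_le_iff)
      then show ?thesis
        using True by (intro curvature_sum_nonneg_certificate [OF sym t, of "\<lambda>_. 0" 1])
          (auto intro!: sum_nonneg)
    next
      case less: False
      have k0: "k > 0" "k \<le> 2 / 3 * CARD('n)" using n k by auto
      define \<theta> where "\<theta> = 1 - spread s / k"
      have \<theta>: "\<theta> \<ge> 0" "\<theta> \<le> 1" "spread s = (1 - \<theta>) * k"
        using less k0 by (auto simp: \<theta>_def spread_def sum_nonneg)
      have \<theta>_le: "\<theta> \<le> 1 / 4 - 3 / 2 * x" if "CARD('n) * (1 / 2 + x) \<le> spread s" for x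
      proof -
        have "CARD('n) * (1 / 2 + x) \<le> (1 - \<theta>) * (2 / 3 * CARD('n))"
          using that \<theta> k0 mult_left_mono [of k "2 / 3 * CARD('n)" "1 - \<theta>"] by linarith
        then have "CARD('n) * (1 / 2 + x) \<le> CARD('n) * (2 / 3 * (1 - \<theta>))"
          by (simp add: mult_ac)
        then have "1 / 2 + x \<le> 2 / 3 * (1 - \<theta>)"
          using n by (subst (asm) mult_le_cancel_left_pos) auto
        then show ?thesis by simp
      qed
      have \<theta>s: "\<theta> \<le> s j * (1 - s j)" if "j \<notin> {i1, i2}" for j
      proof -
        have "\<theta> \<le> 1 / 4 - 3 / 2 * ((1 - 2 * s j)\<^sup>2 / 6)"
          using spread_ge_entry [OF ne s1 s2 n(1) that] by (intro \<theta>_le) (simp add: algebra_simps)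
        also have "\<dots> = s j * (1 - s j)" by (simp add: power2_eq_square field_simps)
        finally show ?thesis .
      qed
      obtain u X where u: "u i1 = 0" "u i2 = 0" "\<And>a. 0 \<le> u a" "(\<Sum>a\<in>UNIV. u a) = 1"
        and X: "0 \<le> X" "\<And>j. j \<notin> {i1, i2} \<Longrightarrow> max 0 (K i1 j - t) = X * u j"
        using weights_exist [OF n(1), of "\<lambda>j. max 0 (K i1 j - t)" i1 i2] by auto
      obtain v Y where v: "v i2 = 0" "v i1 = 0" "\<And>a. 0 \<le> v a" "(\<Sum>a\<in>UNIV. v a) = 1"
        and Y: "0 \<le> Y" "\<And>j. j \<notin> {i2, i1} \<Longrightarrow> max 0 (K i2 j - t) = Y * v j"
        using weights_exist [OF n(1), of "\<lambda>j. max 0 (K i2 j - t)" i2 i1] by auto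
      consider (max) "\<forall>j. j \<notin> {i1, i2} \<longrightarrow> \<theta> * ((\<Sum>a\<in>UNIV. u a * s a) - u j) \<le> (1 - s j)\<^sup>2"
        | (min) "\<forall>j. j \<notin> {i2, i1} \<longrightarrow> \<theta> * ((\<Sum>a\<in>UNIV. v a * (1 - s a)) - v j) \<le> (1 - (1 - s j))\<^sup>2"
        | (neither) j i where "j \<notin> {i1, i2}" "(1 - s j)\<^sup>2 < \<theta> * ((\<Sum>a\<in>UNIV. u a * s a) - u j)"
            "i \<notin> {i2, i1}" "(1 - (1 - s i))\<^sup>2 < \<theta> * ((\<Sum>a\<in>UNIV. v a * (1 - s a)) - v i)"
        unfolding not_le [symmetric] by blast
      then show ?thesis
      proof cases
        case max
        have "(\<Sum>b\<in>-{a}. K a b) = r i1 - d * s a" for a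
          unfolding row by (rule rs)
        from curvature_sum_nonneg_weights [OF sym this n k t ne s1 s2 s01 \<theta> \<theta>s u X max [rule_format]]
        show ?thesis .
      next
        case min
        have row': "(\<Sum>b\<in>-{a}. K a b) = (r i1 - d) - (- d) * (1 - s a)" for a
          unfolding row rs [of a] by (simp add: algebra_simps)
        have ends: "i2 \<noteq> i1" "1 - s i2 = 0" "1 - s i1 = 1" "0 \<le> 1 - s a" "1 - s a \<le> 1" for a
          using ne s1 s2 s01 [of a] by auto
        have \<theta>': "spread (\<lambda>a. 1 - s a) = (1 - \<theta>) * k" using \<theta>(3) by (simp add: spread_reflect)
        have \<theta>s': "\<theta> \<le> (1 - s j) * (1 - (1 - s j))" if "j \<notin> {i2, i1}" for j
          using \<theta>s [of j] that by (auto simp: mult.commute)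
        have "0 \<le> (\<Sum>a\<in>UNIV. \<Sum>b\<in>-{a}. K a b * ((1 - s a) - (1 - s b))\<^sup>2)"
          by (rule curvature_sum_nonneg_weights [OF sym row' n k t ends \<theta>(1,2) \<theta>' \<theta>s' v Y
                min [rule_format]])
        also have "\<dots> = (\<Sum>a\<in>UNIV. \<Sum>b\<in>-{a}. K a b * (s a - s b)\<^sup>2)"
          by (intro sum.cong refl) (simp add: power2_commute)
        finally show ?thesis .
      next
        case neither
        obtain l where l: "l \<notin> {i1, i2}" "l \<noteq> j" "(1 - s j)\<^sup>2 < \<theta> * s l"
          using exceeding_entry [OF u s01(2) \<theta>(1) neither(2)] by blast
        obtain l' where l': "l' \<notin> {i2, i1}" "l' \<noteq> i" "(1 - (1 - s i))\<^sup>2 < \<theta> * (1 - s l')"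
          using exceeding_entry [OF v, of "\<lambda>a. 1 - s a", OF _ \<theta>(1) neither(4)] s01 by auto
        define S where "S = s j - s i"
        define y where "y = s l - s l'"
        \<comment> \<open>For \<open>y < 0\<close> only the gap between \<open>s j\<close> and \<open>s i\<close> is used.\<close>
        define z where "z = max 0 y"
        have \<theta>4: "\<theta> \<le> 1 / 4"
          using \<theta>s [OF neither(1)] zero_le_power2 [of "1 - 2 * s j"] by (simp add: power2_eq_square algebra_simps)
        have "(1 - s j)\<^sup>2 < (1 / 2)\<^sup>2"
        proof -
          have "\<theta> * s l \<le> 1 / 4 * 1" using \<theta>4 \<theta>(1) s01 by (intro mult_mono) auto
          then show ?thesis using l(3) by (simp add: power2_eq_square)
        qed
        then have "1 - s j < 1 / 2" by (rule power2_less_imp_less) simp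
        moreover have "(s i)\<^sup>2 < (1 / 2)\<^sup>2"
        proof -
          have "\<theta> * (1 - s l') \<le> 1 / 4 * 1" using \<theta>4 \<theta>(1) s01 by (intro mult_mono) auto
          then show ?thesis using l'(3) by (simp add: power2_eq_square)
        qed
        then have "s i < 1 / 2" by (rule power2_less_imp_less) simp
        ultimately have S0: "S \<ge> 0" by (simp add: S_def)
        have "(1 - s j)\<^sup>2 + (s i)\<^sup>2 < \<theta> * (1 + y)"
          using l(3) l'(3) by (simp add: y_def algebra_simps)
        also have "\<dots> \<le> \<theta> * (1 + z)"
          using \<theta>(1) by (intro mult_left_mono) (auto simp: z_def)
        also have "\<dots> \<le> (1 / 4 - 3 / 4 * (S\<^sup>2 + z\<^sup>2)) * (1 + z)"
        proof (intro mult_right_mono)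
          have "z * y = z * z" by (auto simp: z_def max_def)
          have "CARD('n) * (1 / 2 + 2 * (S / 2) * S + 2 * (z / 2) * y
             - 2 * (S / 2)\<^sup>2 - 2 * (z / 2)\<^sup>2) \<le> spread s"
            unfolding S_def y_def using neither l l' S0
            by (intro spread_ge_two_gaps [OF ne s1 s2 n(1)]) (auto simp: S_def z_def)
          also have "1 / 2 + 2 * (S / 2) * S + 2 * (z / 2) * y - 2 * (S / 2)\<^sup>2 - 2 * (z / 2)\<^sup>2
             = 1 / 2 + (S\<^sup>2 + z\<^sup>2) / 2"
            using \<open>z * y = z * z\<close> by (simp add: power2_eq_square field_simps)
          finally have "\<theta> \<le> 1 / 4 - 3 / 2 * ((S\<^sup>2 + z\<^sup>2) / 2)" by (rule \<theta>_le)
          then show "\<theta> \<le> 1 / 4 - 3 / 4 * (S\<^sup>2 + z\<^sup>2)" by simp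
        qed (simp add: z_def)
        also have "\<dots> \<le> (1 - S)\<^sup>2 / 2" by (rule two_gaps_real) (simp add: z_def)
        also have "\<dots> \<le> (1 - s j)\<^sup>2 + (s i)\<^sup>2"
        proof -
          have "(1 - s j)\<^sup>2 + (s i)\<^sup>2 - (1 - S)\<^sup>2 / 2 = (1 - s j - s i)\<^sup>2 / 2"
            by (simp add: S_def power2_eq_square field_simps)
          then show ?thesis using zero_le_power2 [of "1 - s j - s i"] by linarith
        qed
        finally show ?thesis by simp
      qed
    qed
    then have "0 \<le> d\<^sup>2 * (\<Sum>a\<in>UNIV. \<Sum>b\<in>-{a}. K a b * (s a - s b)\<^sup>2)" by simp
    also have "\<dots> = (\<Sum>a\<in>UNIV. \<Sum>b\<in>-{a}. K a b * (r a - r b)\<^sup>2)"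
    proof -
      have "r a - r b = d * (s b - s a)" for a b
        using rs [of a] rs [of b] by (simp add: right_diff_distrib)
      then have "(r a - r b)\<^sup>2 = d\<^sup>2 * (s a - s b)\<^sup>2" for a b
        using power2_commute [of "s a" "s b"] by (simp add: power_mult_distrib)
      then show ?thesis
        unfolding sum_distrib_left by (simp only: mult.left_commute)
    qed
    finally show ?thesis .
  qed
qed


section \<open>Curvature operators in an orthonormal frame\<close>

definition frame :: "('n \<Rightarrow> real ^ 'n) \<Rightarrow> bool" where
  "frame e \<longleftrightarrow> (\<forall>a b. e a \<bullet> e b = (if a = b then 1 else 0))"

lemma frame_axis: "frame (\<lambda>a. axis a 1)"
  by (simp add: frame_def inner_axis_axis)

lemma frame_inner: "frame e \<Longrightarrow> e a \<bullet> e b = (if a = b then 1 else 0)"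
  by (simp add: frame_def)

lemma frame_expand:
  assumes e: "frame e"
  shows "x = (\<Sum>a\<in>UNIV. (x \<bullet> e a) *\<^sub>R e a)"
proof -
  have inj: "inj e"
    using frame_inner [OF e] by (metis injI zero_neq_one)
  have "pairwise orthogonal (range e)"
    using frame_inner [OF e] by (auto simp: pairwise_def orthogonal_def)
  moreover have "0 \<notin> range e"
    using frame_inner [OF e] by (metis imageE inner_zero_left zero_neq_one)
  ultimately have "independent (range e)"
    by (rule pairwise_orthogonal_independent)
  then have span: "UNIV \<subseteq> span (range e)"
    using inj by (intro card_ge_dim_independent) (auto simp: card_image)
  define w where "w = x - (\<Sum>a\<in>UNIV. (x \<bullet> e a) *\<^sub>R e a)"
  have "w \<bullet> e b = 0" for b
    by (simp add: w_def inner_diff_left inner_sum_left frame_inner [OF e] if_distrib cong: if_cong)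
  then have "orthogonal w y" if "y \<in> range e" for y
    using that by (auto simp: orthogonal_def)
  then have "orthogonal w w"
    using span orthogonal_to_span [of w "range e" w] by blast
  then show ?thesis by (simp add: orthogonal_def w_def)
qed

lemma linear_frame_expand:
  assumes e: "frame e" and f: "linear f"
  shows "f x = (\<Sum>a\<in>UNIV. (x \<bullet> e a) *\<^sub>R f (e a))"
  by (subst frame_expand [OF e, of x]) (simp add: linear_sum [OF f] linear_scale [OF f])

lemma frame_trace:
  fixes B :: "real ^ 'n \<Rightarrow> real ^ 'n \<Rightarrow> real"
  assumes e: "frame e" and B: "bilinear B"
  shows "(\<Sum>x\<in>Basis. B x x) = (\<Sum>a\<in>UNIV. B (e a) (e a))"
proof -
  have l: "linear (\<lambda>x. B x y)" "linear (B x)" for x y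
    using B by (auto simp: bilinear_def)
  have "B x x = (\<Sum>a\<in>UNIV. \<Sum>b\<in>UNIV. B (e a) (e b) * ((e a \<bullet> x) * (e b \<bullet> x)))" for x
  proof -
    have "B x x = (\<Sum>a\<in>UNIV. (x \<bullet> e a) * B (e a) x)"
      using linear_frame_expand [OF e l(1), of x x] by simp
    also have "\<dots> = (\<Sum>a\<in>UNIV. (x \<bullet> e a) * (\<Sum>b\<in>UNIV. (x \<bullet> e b) * B (e a) (e b)))"
      by (subst linear_frame_expand [OF e l(2), of _ x]) simp
    finally show ?thesis
      by (simp add: sum_distrib_left inner_commute mult_ac)
  qed
  then have "(\<Sum>x\<in>Basis. B x x)
      = (\<Sum>x\<in>Basis. \<Sum>a\<in>UNIV. \<Sum>b\<in>UNIV. B (e a) (e b) * ((e a \<bullet> x) * (e b \<bullet> x)))"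
    by simp
  also have "\<dots> = (\<Sum>a\<in>UNIV. \<Sum>b\<in>UNIV. \<Sum>x\<in>Basis. B (e a) (e b) * ((e a \<bullet> x) * (e b \<bullet> x)))"
    by (subst sum.swap, intro sum.cong refl, subst sum.swap, rule refl)
  also have "\<dots> = (\<Sum>a\<in>UNIV. \<Sum>b\<in>UNIV. B (e a) (e b) * (e a \<bullet> e b))"
    by (simp add: sum_distrib_left [symmetric] euclidean_inner [symmetric])
  also have "\<dots> = (\<Sum>a\<in>UNIV. B (e a) (e a))"
    by (simp add: frame_inner [OF e] if_distrib cong: if_cong)
  finally show ?thesis .
qed

lemma frame_norm_squared:
  fixes h :: "real ^ 'n \<Rightarrow> real ^ 'n \<Rightarrow> real"
  assumes e: "frame e" and h: "bilinear h"
  shows "(tensor_norm h)\<^sup>2 = (\<Sum>a\<in>UNIV. \<Sum>b\<in>UNIV. (h (e a) (e b))\<^sup>2)"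
proof -
  have l: "linear (\<lambda>x. h x y)" "linear (h x)" for x y
    using h by (auto simp: bilinear_def)
  have sq: "bilinear (\<lambda>x y. g x * g y)" if "linear g" for g :: "real ^ 'n \<Rightarrow> real"
    using that by (auto simp: bilinear_def linear_iff algebra_simps)
  have tr: "(\<Sum>x\<in>Basis. (g x)\<^sup>2) = (\<Sum>a\<in>UNIV. (g (e a))\<^sup>2)" if "linear g" for g :: "real ^ 'n \<Rightarrow> real"
    unfolding power2_eq_square by (rule frame_trace [OF e sq [OF that]])
  have "(tensor_norm h)\<^sup>2 = (\<Sum>x\<in>Basis. \<Sum>y\<in>Basis. (h x y)\<^sup>2)"
    by (simp add: tensor_norm_def sum_nonneg)
  also have "\<dots> = (\<Sum>b\<in>UNIV. \<Sum>x\<in>Basis. (h x (e b))\<^sup>2)"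
    by (subst sum.swap) (simp add: tr [OF l(2)])
  also have "\<dots> = (\<Sum>a\<in>UNIV. \<Sum>b\<in>UNIV. (h (e a) (e b))\<^sup>2)"
    by (subst sum.swap) (simp add: tr [OF l(1)])
  finally show ?thesis .
qed

lemma symmetric_tensor_diagonal:
  fixes h :: "real ^ 'n \<Rightarrow> real ^ 'n \<Rightarrow> real"
  assumes "symmetric_two_tensor h"
  obtains e \<mu> where "frame e" "\<And>a b. h (e a) (e b) = (if a = b then \<mu> a else 0)"
proof -
  have h: "bilinear h" and sym: "h x y = h y x" for x y
    using assms by (auto simp: symmetric_two_tensor_def)
  have l: "linear (\<lambda>x. h x y)" "linear (h x)" for x y
    using h by (auto simp: bilinear_def)
  define f where "f = (\<lambda>x. \<chi> i. h x (axis i 1))"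
  have f: "linear f"
    by (intro linearI) (simp_all add: f_def vec_eq_iff linear_add [OF l(1)] linear_scale [OF l(1)])
  have fh: "f x \<bullet> y = h x y" for x y
  proof -
    have "h x y = (\<Sum>a\<in>UNIV. y $ a * h x (axis a 1))"
      by (subst linear_frame_expand [OF frame_axis l(2)]) (simp add: inner_axis)
    then show ?thesis by (simp add: f_def inner_vec_def mult.commute)
  qed
  have sa: "f x \<bullet> y = x \<bullet> f y" for x y
    by (metis fh inner_commute sym)
  have "\<exists>B c. pairwise orthogonal B \<and> span B = (UNIV :: (real ^ 'n) set)
      \<and> (\<forall>b\<in>B. norm b = 1 \<and> f b = c b *\<^sub>R b)"
    by (intro self_adjoint_eigenbasis [OF f]) (simp_all add: sa)
  then obtain B c where B: "pairwise orthogonal B" "span B = (UNIV :: (real ^ 'n) set)"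
      "\<And>b. b \<in> B \<Longrightarrow> norm b = 1" "\<And>b. b \<in> B \<Longrightarrow> f b = c b *\<^sub>R b"
    by blast
  have "0 \<notin> B" using B(3) by force
  then have indep: "independent B" using B(1) by (simp add: pairwise_orthogonal_independent)
  then have "finite B" by (rule independent_imp_finite)
  moreover have "card B = CARD('n)"
    using indep B(2) dim_span [of B] dim_eq_card_independent [of B] by simp
  ultimately obtain e where e: "bij_betw e (UNIV :: 'n set) B"
    by (metis finite_same_card_bij finite)
  have mem: "e a \<in> B" for a using e by (auto simp: bij_betw_def)
  have frame: "e a \<bullet> e b = (if a = b then 1 else 0)" for a b
  proof (cases "a = b")
    case True
    then show ?thesis using B(3) [OF mem [of b]] by (simp add: dot_square_norm)
  next
    case False
    then have "e a \<noteq> e b" using e by (auto simp: bij_betw_def inj_on_def)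
    then show ?thesis using False B(1) mem by (auto simp: pairwise_def orthogonal_def)
  qed
  have "h (e a) (e b) = (if a = b then c (e a) else 0)" for a b
    unfolding fh [symmetric] B(4) [OF mem] by (simp add: frame)
  then show ?thesis using frame by (intro that [of e "\<lambda>a. c (e a)"]) (auto simp: frame_def)
qed

lemma bilinear_wedge: "bilinear wedge"
  by (auto simp: bilinear_def linear_iff vec_eq_iff wedge_component algebra_simps)

lemma inner_biv_commute: "inner_biv A B = inner_biv B A"
  by (simp add: inner_biv_def inner_commute)

lemma inner_biv_sum_left:
  "inner_biv (\<Sum>i\<in>I. c i *\<^sub>R v i) A = (\<Sum>i\<in>I. c i * inner_biv (v i) A)"
  by (simp add: inner_biv_def inner_sum_left sum_divide_distrib)

lemma inner_biv_wedge_right: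
  assumes "L \<in> bivectors"
  shows "inner_biv L (wedge x y) = (L *v x) \<bullet> y"
proof -
  have skew: "L $ i $ j = - L $ j $ i" for i j using assms bivectors_iff by blast
  have "L \<bullet> wedge x y = (\<Sum>i\<in>UNIV. \<Sum>j\<in>UNIV. L $ i $ j * (x $ j * y $ i)) - (\<Sum>i\<in>UNIV. \<Sum>j\<in>UNIV. L $ i $ j * (x $ i * y $ j))"
    by (simp add: inner_vec_def wedge_component sum_subtractf [symmetric] algebra_simps)
  also have "(\<Sum>i\<in>UNIV. \<Sum>j\<in>UNIV. L $ i $ j * (x $ i * y $ j)) = - (\<Sum>i\<in>UNIV. \<Sum>j\<in>UNIV. L $ i $ j * (x $ j * y $ i))"
    by (subst sum.swap, subst skew) (simp add: sum_negf)
  also have "(\<Sum>i\<in>UNIV. \<Sum>j\<in>UNIV. L $ i $ j * (x $ j * y $ i)) = (L *v x) \<bullet> y"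
    by (simp add: inner_vec_def matrix_vector_mult_def sum_distrib_left mult_ac)
  finally show ?thesis by (simp add: inner_biv_def)
qed

lemma frame_sum_wedge_squared:
  fixes L :: "real ^ 'n ^ 'n"
  assumes e: "frame e" and L: "L \<in> bivectors"
  shows "(\<Sum>a\<in>UNIV. \<Sum>b\<in>UNIV. (inner_biv L (wedge (e a) (e b)))\<^sup>2) = 2 * inner_biv L L"
proof -
  define h where "h = (\<lambda>x y. (L *v x) \<bullet> y)"
  have h: "bilinear h"
    by (auto simp: bilinear_def linear_iff h_def matrix_vector_right_distrib inner_add_left inner_add_right
        matrix_vector_mult_scaleR)
  have "(\<Sum>a\<in>UNIV. \<Sum>b\<in>UNIV. (inner_biv L (wedge (e a) (e b)))\<^sup>2) = (\<Sum>a\<in>UNIV. \<Sum>b\<in>UNIV. (h (e a) (e b))\<^sup>2)"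
    by (simp add: inner_biv_wedge_right [OF L] h_def)
  also have "\<dots> = (\<Sum>a\<in>UNIV. \<Sum>b\<in>UNIV. (h (axis a 1) (axis b 1))\<^sup>2)"
    unfolding frame_norm_squared [OF e h, symmetric] by (rule frame_norm_squared [OF frame_axis h])
  also have "\<dots> = (\<Sum>a\<in>UNIV. \<Sum>b\<in>UNIV. (L $ b $ a)\<^sup>2)"
    by (simp add: h_def inner_axis matrix_vector_mult_basis column_def)
  also have "\<dots> = L \<bullet> L"
    by (subst sum.swap) (simp add: inner_vec_def power2_eq_square)
  finally show ?thesis by (simp add: inner_biv_def)
qed

lemma biv_act_frame:
  assumes e: "frame e" and h: "bilinear h" and \<mu>: "\<And>a b. h (e a) (e b) = (if a = b then \<mu> a else 0)"
    and L: "L \<in> bivectors"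
  shows "biv_act L h (e a) (e b) = (\<mu> a - \<mu> b) * inner_biv L (wedge (e a) (e b))"
proof -
  have l: "linear (\<lambda>x. h x y)" "linear (h x)" for x y
    using h by (auto simp: bilinear_def)
  have "h x (e b) = \<mu> b * (x \<bullet> e b)" for x b
    by (subst linear_frame_expand [OF e l(1)]) (simp add: \<mu> if_distrib cong: if_cong)
  moreover have "h (e a) x = \<mu> a * (x \<bullet> e a)" for x a
    by (subst linear_frame_expand [OF e l(2)]) (simp add: \<mu> if_distrib cong: if_cong)
  moreover have "(L *v e b) \<bullet> e a = - ((L *v e a) \<bullet> e b)"
  proof -
    have "wedge (e b) (e a) = - wedge (e a) (e b)" by (simp add: vec_eq_iff wedge_component)
    then show ?thesis
      by (simp add: inner_biv_wedge_right [OF L, symmetric] inner_biv_def)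
  qed
  ultimately show ?thesis
    by (simp add: biv_act_def inner_biv_wedge_right [OF L] algebra_simps)
qed

lemma eigenbasis_quadratic:
  fixes R :: "real ^ 'n ^ 'n \<Rightarrow> real ^ 'n ^ 'n"
  assumes R: "self_adjoint_biv R" and o: "ordered_eigenbasis R l \<eta>" and A: "A \<in> bivectors"
  shows "inner_biv (R A) A = (\<Sum>i = 1..CARD('n) choose 2. l i * (inner_biv A (\<eta> i))\<^sup>2)"
    and "inner_biv A A = (\<Sum>i = 1..CARD('n) choose 2. (inner_biv A (\<eta> i))\<^sup>2)"
proof -
  let ?I = "{1..CARD('n) choose 2}"
  obtain f where f: "linear f" and fR: "\<And>A. A \<in> bivectors \<Longrightarrow> f A = R A"
    using self_adjoint_biv_extend_linear [OF R] by blast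
  have eb: "\<eta> i \<in> bivectors" "R (\<eta> i) = l i *\<^sub>R \<eta> i" if "i \<in> ?I" for i
    using o that by (auto simp: ordered_eigenbasis_def)
  note ex = ordered_eigenbasis_expand [OF o A]
  have "inner_biv A A = inner_biv (\<Sum>i\<in>?I. inner_biv A (\<eta> i) *\<^sub>R \<eta> i) A"
    using ex by simp
  also have "\<dots> = (\<Sum>i\<in>?I. (inner_biv A (\<eta> i))\<^sup>2)"
    unfolding inner_biv_sum_left by (simp add: power2_eq_square inner_biv_commute)
  finally show "inner_biv A A = (\<Sum>i\<in>?I. (inner_biv A (\<eta> i))\<^sup>2)" .
  have "R A = f (\<Sum>i\<in>?I. inner_biv A (\<eta> i) *\<^sub>R \<eta> i)"
    using ex fR [OF A] by simp
  also have "\<dots> = (\<Sum>i\<in>?I. (inner_biv A (\<eta> i) * l i) *\<^sub>R \<eta> i)"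
    unfolding linear_sum [OF f] linear_scale [OF f] by (intro sum.cong refl) (simp add: fR eb)
  finally have "inner_biv (R A) A = inner_biv (\<Sum>i\<in>?I. (inner_biv A (\<eta> i) * l i) *\<^sub>R \<eta> i) A"
    by simp
  also have "\<dots> = (\<Sum>i\<in>?I. l i * (inner_biv A (\<eta> i))\<^sup>2)"
    unfolding inner_biv_sum_left by (simp add: power2_eq_square inner_biv_commute mult_ac)
  finally show "inner_biv (R A) A = (\<Sum>i\<in>?I. l i * (inner_biv A (\<eta> i))\<^sup>2)" .
qed

lemma Q_frame:
  fixes R :: "real ^ 'n ^ 'n \<Rightarrow> real ^ 'n ^ 'n"
  assumes R: "self_adjoint_biv R" and e: "frame e" and h: "bilinear h"
    and \<mu>: "\<And>a b. h (e a) (e b) = (if a = b then \<mu> a else 0)"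
  shows "Q R h = (\<Sum>a\<in>UNIV. \<Sum>b\<in>-{a}. curvature_tensor R (e a) (e b) (e a) (e b) * (\<mu> a - \<mu> b)\<^sup>2)"
proof -
  let ?I = "{1..CARD('n) choose 2}"
  note o = ordered_eigenbasis_eigensystem [OF R]
  have eb: "eigvec R i \<in> bivectors" if "i \<in> ?I" for i
    using o that by (auto simp: ordered_eigenbasis_def)
  have bil: "bilinear (biv_act L h)" for L
    using h unfolding bilinear_def biv_act_def
    by (auto simp: linear_iff matrix_vector_right_distrib matrix_vector_mult_scaleR algebra_simps)
  have "Q R h = (\<Sum>i\<in>?I. eigval R i * (\<Sum>a\<in>UNIV. \<Sum>b\<in>UNIV. (\<mu> a - \<mu> b)\<^sup>2 * (inner_biv (wedge (e a) (e b)) (eigvec R i))\<^sup>2))"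
    unfolding Q_def
    by (intro sum.cong refl)
       (simp add: frame_norm_squared [OF e bil] biv_act_frame [OF e h \<mu>] eb power_mult_distrib inner_biv_commute)
  also have "\<dots> = (\<Sum>a\<in>UNIV. \<Sum>b\<in>UNIV. \<Sum>i\<in>?I. eigval R i * ((\<mu> a - \<mu> b)\<^sup>2 * (inner_biv (wedge (e a) (e b)) (eigvec R i))\<^sup>2))"
    unfolding sum_distrib_left by (subst sum.swap, intro sum.cong refl, subst sum.swap, rule refl)
  also have "\<dots> = (\<Sum>a\<in>UNIV. \<Sum>b\<in>UNIV. curvature_tensor R (e a) (e b) (e a) (e b) * (\<mu> a - \<mu> b)\<^sup>2)"
    by (simp add: curvature_tensor_def eigenbasis_quadratic(1) [OF R o] sum_distrib_left mult_ac)
  also have "\<dots> = (\<Sum>a\<in>UNIV. \<Sum>b\<in>-{a}. curvature_tensor R (e a) (e b) (e a) (e b) * (\<mu> a - \<mu> b)\<^sup>2)"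
    by (intro sum.cong refl sum.mono_neutral_right) auto
  finally show ?thesis .
qed

lemma curvature_tensor_linear:
  fixes R :: "real ^ 'n ^ 'n \<Rightarrow> real ^ 'n ^ 'n"
  assumes R: "self_adjoint_biv R"
  shows "linear (\<lambda>x. curvature_tensor R x y z w)" "linear (\<lambda>y. curvature_tensor R x y z w)"
    "linear (\<lambda>z. curvature_tensor R x y z w)" "linear (\<lambda>w. curvature_tensor R x y z w)"
proof -
  obtain f where f: "linear f" and fR: "\<And>A. A \<in> bivectors \<Longrightarrow> f A = R A"
    using self_adjoint_biv_extend_linear [OF R] by blast
  have w: "linear (\<lambda>x. wedge x y)" "linear (wedge x)" for x y :: "real ^ 'n"
    using bilinear_wedge by (auto simp: bilinear_def)
  note l = linear_add [OF f] linear_scale [OF f] linear_add [OF w(1)] linear_scale [OF w(1)]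
    linear_add [OF w(2)] linear_scale [OF w(2)]
  show "linear (\<lambda>x. curvature_tensor R x y z w)" "linear (\<lambda>y. curvature_tensor R x y z w)"
    "linear (\<lambda>z. curvature_tensor R x y z w)" "linear (\<lambda>w. curvature_tensor R x y z w)"
    unfolding curvature_tensor_def fR [OF wedge_in_bivectors, symmetric] inner_biv_def
    by (auto intro!: linearI simp: l inner_add_left inner_add_right add_divide_distrib)
qed

lemma curvature_tensor_pair_symmetric:
  assumes R: "self_adjoint_biv R"
  shows "curvature_tensor R x y z w = curvature_tensor R z w x y"
  using R unfolding self_adjoint_biv_def curvature_tensor_def
  by (metis inner_biv_commute wedge_in_bivectors)

lemma curvature_tensor_swap:
  assumes R: "self_adjoint_biv R"
  shows "curvature_tensor R y x y x = curvature_tensor R x y x y"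
proof -
  obtain f where f: "linear f" and fR: "\<And>A. A \<in> bivectors \<Longrightarrow> f A = R A"
    using self_adjoint_biv_extend_linear [OF R] by blast
  have w: "wedge y x = - wedge x y" by (simp add: vec_eq_iff wedge_component)
  have "f (wedge y x) = - f (wedge x y)" unfolding w by (rule linear_neg [OF f])
  then have "R (wedge y x) = - R (wedge x y)" unfolding fR [OF wedge_in_bivectors] .
  then show ?thesis by (simp add: curvature_tensor_def w inner_biv_def)
qed

lemma curvature_tensor_degenerate:
  assumes R: "self_adjoint_biv R"
  shows "curvature_tensor R x x z w = 0"
proof -
  have "wedge x x = wedge 0 0" by (simp add: vec_eq_iff wedge_component)
  then have "curvature_tensor R x x z w = curvature_tensor R 0 0 z w"
    by (simp add: curvature_tensor_def)
  then show ?thesis using linear_0 [OF curvature_tensor_linear(1) [OF R, of 0 z w]] by simp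
qed

lemma Ric_frame:
  assumes R: "self_adjoint_biv R" and e: "frame e"
  shows "Ric R x y = (\<Sum>a\<in>UNIV. curvature_tensor R x (e a) y (e a))"
  unfolding Ric_def using curvature_tensor_linear [OF R]
  by (intro frame_trace [OF e]) (auto simp: bilinear_def)

lemma symmetric_two_tensor_Ric:
  assumes R: "self_adjoint_biv R"
  shows "symmetric_two_tensor (Ric R)"
  unfolding symmetric_two_tensor_def bilinear_def Ric_def
  using curvature_tensor_linear [OF R] curvature_tensor_pair_symmetric [OF R]
  by (auto intro!: linear_compose_sum)

text \<open>
The threshold is the first eigenvalue that is not fully counted in the partial sum, so that
\<open>\<Sum>\<^sub>i max 0 (t - \<lambda>\<^sub>i) = k t - \<Sigma>\<^sub>k\<close>. A sectional curvature is an average of the eigenvalues with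
weights \<open>\<langle>e\<^sub>a \<and> e\<^sub>b, \<eta>\<^sub>i\<rangle>\<^sup>2\<close>, and these weights are doubly stochastic up to the factor \<open>2\<close> from
ordered pairs, so by convexity of \<open>max 0\<close> the curvatures satisfy the bound that the eigenvalues do.
\<close>

lemma k_nonnegative_threshold:
  fixes R :: "real ^ 'n ^ 'n \<Rightarrow> real ^ 'n ^ 'n"
  assumes R: "self_adjoint_biv R" and k: "k_nonnegative k R" "1 \<le> k" "nat \<lfloor>k\<rfloor> + 1 \<le> CARD('n) choose 2"
    and e: "frame e"
  obtains t where "t \<ge> 0"
    "(\<Sum>a\<in>UNIV. \<Sum>b\<in>-{a}. max 0 (t - curvature_tensor R (e a) (e b) (e a) (e b))) \<le> 2 * k * t"
proof -
  define N where "N = CARD('n) choose 2"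
  define m where "m = nat \<lfloor>k\<rfloor>"
  define t where "t = eigval R (m + 1)"
  have m: "1 \<le> m" "m + 1 \<le> N" "real m \<le> k" "k < real m + 1" "real_of_int \<lfloor>k\<rfloor> = real m"
    using k by (auto simp: m_def N_def of_nat_nat le_nat_iff le_floor_iff)
  note o = ordered_eigenbasis_eigensystem [OF R]
  have mono: "eigval R i \<le> eigval R j" if "i \<in> {1..N}" "j \<in> {1..N}" "i \<le> j" for i j
    using o that by (auto simp: ordered_eigenbasis_def N_def mono_on_def)
  have S: "0 \<le> (\<Sum>i = 1..m. eigval R i) + (k - m) * t"
    using k(1) m(5) by (simp add: k_nonnegative_def eigval_sum_def m_def [symmetric] t_def)
  have low: "eigval R i \<le> t" if "i \<in> {1..m}" for i
    unfolding t_def using that m by (intro mono) auto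
  have t: "t \<ge> 0"
  proof -
    have "(\<Sum>i = 1..m. eigval R i) \<le> (\<Sum>i = 1..m. t)" by (rule sum_mono) (rule low)
    then have "0 \<le> k * t" using S by (simp add: left_diff_distrib)
    then show ?thesis using k(2) by (simp add: zero_le_mult_iff)
  qed
  have gap: "(\<Sum>i = 1..N. max 0 (t - eigval R i)) \<le> k * t"
  proof -
    have "(\<Sum>i = 1..N. max 0 (t - eigval R i)) = (\<Sum>i = 1..m. max 0 (t - eigval R i))"
    proof (rule sum.mono_neutral_right)
      show "\<forall>i\<in>{1..N} - {1..m}. max 0 (t - eigval R i) = 0"
      proof
        fix i assume "i \<in> {1..N} - {1..m}"
        then have "t \<le> eigval R i" unfolding t_def using m by (intro mono) auto
        then show "max 0 (t - eigval R i) = 0" by simp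
      qed
    qed (use m in auto)
    also have "\<dots> = (\<Sum>i = 1..m. t - eigval R i)" using low by (intro sum.cong) auto
    also have "\<dots> \<le> k * t" using S by (simp add: sum_subtractf left_diff_distrib)
    finally show ?thesis .
  qed
  define c where "c = (\<lambda>a b i. (inner_biv (wedge (e a) (e b)) (eigvec R i))\<^sup>2)"
  have jensen: "max 0 (t - curvature_tensor R (e a) (e b) (e a) (e b))
      \<le> (\<Sum>i = 1..N. max 0 (t - eigval R i) * c a b i)" if "b \<in> -{a}" for a b
  proof -
    have c1: "(\<Sum>i = 1..N. c a b i) = 1"
      using eigenbasis_quadratic(2) [OF R o, of "wedge (e a) (e b)"] that
      by (simp add: c_def N_def inner_biv_wedge frame_inner [OF e])
    have "t - curvature_tensor R (e a) (e b) (e a) (e b) = (\<Sum>i = 1..N. (t - eigval R i) * c a b i)"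
      using c1 by (simp add: curvature_tensor_def eigenbasis_quadratic(1) [OF R o] c_def N_def
        left_diff_distrib sum_subtractf sum_distrib_left [symmetric])
    also have "\<dots> \<le> (\<Sum>i = 1..N. max 0 (t - eigval R i) * c a b i)"
      by (intro sum_mono mult_right_mono) (auto simp: c_def)
    finally show ?thesis by (auto simp: c_def intro!: sum_nonneg)
  qed
  have "(\<Sum>a\<in>UNIV. \<Sum>b\<in>-{a}. max 0 (t - curvature_tensor R (e a) (e b) (e a) (e b)))
     \<le> (\<Sum>a\<in>UNIV. \<Sum>b\<in>-{a}. \<Sum>i = 1..N. max 0 (t - eigval R i) * c a b i)"
    by (intro sum_mono jensen)
  also have "\<dots> \<le> (\<Sum>a\<in>UNIV. \<Sum>b\<in>UNIV. \<Sum>i = 1..N. max 0 (t - eigval R i) * c a b i)"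
    by (intro sum_mono sum_mono2) (auto simp: c_def intro!: sum_nonneg)
  also have "\<dots> = (\<Sum>i = 1..N. max 0 (t - eigval R i) * (\<Sum>a\<in>UNIV. \<Sum>b\<in>UNIV. c a b i))"
    unfolding sum_distrib_left by (subst (2) sum.swap, subst sum.swap, rule refl)
  also have "\<dots> = (\<Sum>i = 1..N. max 0 (t - eigval R i) * 2)"
  proof (intro sum.cong refl)
    fix i assume i: "i \<in> {1..N}"
    then have "eigvec R i \<in> bivectors" "inner_biv (eigvec R i) (eigvec R i) = 1"
      using o by (auto simp: ordered_eigenbasis_def N_def)
    then have "(\<Sum>a\<in>UNIV. \<Sum>b\<in>UNIV. c a b i) = 2"
      using frame_sum_wedge_squared [OF e, of "eigvec R i"] by (simp add: c_def inner_biv_commute)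
    then show "max 0 (t - eigval R i) * (\<Sum>a\<in>UNIV. \<Sum>b\<in>UNIV. c a b i) = max 0 (t - eigval R i) * 2"
      by simp
  qed
  also have "\<dots> \<le> 2 * k * t" using gap by (simp add: sum_distrib_right [symmetric])
  finally show ?thesis using t that by blast
qed


section \<open>Nonnegativity for the Ricci tensor, and diagonal curvature operators\<close>

lemma floor_index_le:
  assumes n: "3 \<le> n" and k: "k = 2 * (real n - 1) / 3"
  shows "1 \<le> k" "nat \<lfloor>k\<rfloor> + 1 \<le> n choose 2"
proof -
  show "1 \<le> k" using n k by simp
  have "\<lfloor>k\<rfloor> < int n - 1" using n by (simp add: floor_less_iff k)
  then have "nat \<lfloor>k\<rfloor> + 1 \<le> n - 1" using n by linarith
  also have "\<dots> = 2 * (n - 1) div 2" by simp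
  also have "\<dots> \<le> n * (n - 1) div 2" using n by (intro div_le_mono mult_le_mono1) simp
  finally show "nat \<lfloor>k\<rfloor> + 1 \<le> n choose 2" by (simp add: choose_two)
qed

lemma Q_Ric_nonneg:
  fixes R :: "real ^ 'n ^ 'n \<Rightarrow> real ^ 'n ^ 'n"
  assumes n: "3 \<le> CARD('n)" "CARD('n) \<le> 341"
    and R: "self_adjoint_biv R" and k: "k_nonnegative (2 * (real CARD('n) - 1) / 3) R"
  shows "0 \<le> Q R (Ric R)"
proof -
  let ?k = "2 * (real CARD('n) - 1) / 3"
  have bil: "bilinear (Ric R)"
    using symmetric_two_tensor_Ric [OF R] by (simp add: symmetric_two_tensor_def)
  obtain e \<mu> where e: "frame e" and \<mu>: "\<And>a b. Ric R (e a) (e b) = (if a = b then \<mu> a else 0)"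
    using symmetric_tensor_diagonal [OF symmetric_two_tensor_Ric [OF R]] by blast
  obtain t where t: "t \<ge> 0"
    "(\<Sum>a\<in>UNIV. \<Sum>b\<in>-{a}. max 0 (t - curvature_tensor R (e a) (e b) (e a) (e b))) \<le> 2 * ?k * t"
    using k_nonnegative_threshold [OF R k floor_index_le [OF n(1) refl] e] by blast
  have "(\<Sum>b\<in>-{a}. curvature_tensor R (e a) (e b) (e a) (e b)) = \<mu> a" for a
  proof -
    have "\<mu> a = (\<Sum>b\<in>UNIV. curvature_tensor R (e a) (e b) (e a) (e b))"
      using \<mu> [of a a] Ric_frame [OF R e, of "e a" "e a"] by simp
    then show ?thesis
      by (simp add: Compl_eq_Diff_UNIV sum_diff1 curvature_tensor_degenerate [OF R])
  qed
  then show ?thesis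
    unfolding Q_frame [OF R e bil \<mu>]
    by (intro curvature_sum_nonneg [OF _ _ n refl t]) (simp_all add: curvature_tensor_swap [OF R])
qed

text \<open>
  For symmetric \<open>\<kappa>\<close> the bivectors of the coordinate planes are eigenvectors, with eigenvalues
  \<open>\<kappa> i j\<close>.
\<close>

definition hadamard :: "('n \<Rightarrow> 'n \<Rightarrow> real) \<Rightarrow> real ^ 'n ^ 'n \<Rightarrow> real ^ 'n ^ 'n" where
  "hadamard \<kappa> A = (\<chi> i j. \<kappa> i j * A $ i $ j)"

text \<open>
The Bianchi identity holds entrywise: the three terms at \<open>i, j\<close> add up to the
projection of \<open>x \<and> y \<and> z\<close> to the coordinate plane of \<open>i\<close> and \<open>j\<close>, contracted with \<open>w\<close>, and a
plane carries no trivectors.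
\<close>

lemma algebraic_curvature_operator_hadamard:
  assumes sym: "\<And>i j. \<kappa> i j = \<kappa> j i"
  shows "algebraic_curvature_operator (hadamard \<kappa>)"
proof -
  have "hadamard \<kappa> A \<in> bivectors" if "A \<in> bivectors" for A
    unfolding bivectors_iff
  proof (intro allI)
    fix i j
    have "A $ i $ j = - A $ j $ i" using that bivectors_iff by blast
    then show "hadamard \<kappa> A $ i $ j = - hadamard \<kappa> A $ j $ i"
      by (simp add: hadamard_def sym [of i j])
  qed
  moreover have "hadamard \<kappa> (A + B) = hadamard \<kappa> A + hadamard \<kappa> B"
      "hadamard \<kappa> (c *\<^sub>R A) = c *\<^sub>R hadamard \<kappa> A"
      "inner_biv (hadamard \<kappa> A) B = inner_biv A (hadamard \<kappa> B)" for A B c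
    by (simp_all add: hadamard_def vec_eq_iff algebra_simps inner_biv_def inner_vec_def)
  ultimately have "self_adjoint_biv (hadamard \<kappa>)" by (simp add: self_adjoint_biv_def)
  moreover have "curvature_tensor (hadamard \<kappa>) x y z w + curvature_tensor (hadamard \<kappa>) y z x w
                + curvature_tensor (hadamard \<kappa>) z x y w = 0" for x y z w
  proof -
    have "hadamard \<kappa> (wedge x y) \<bullet> wedge z w + hadamard \<kappa> (wedge y z) \<bullet> wedge x w
       + hadamard \<kappa> (wedge z x) \<bullet> wedge y w
       = (\<Sum>i\<in>UNIV. \<Sum>j\<in>UNIV. \<kappa> i j * (wedge x y $ i $ j * wedge z w $ i $ j
          + wedge y z $ i $ j * wedge x w $ i $ j + wedge z x $ i $ j * wedge y w $ i $ j))"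
      by (simp add: inner_vec_def hadamard_def sum.distrib distrib_left mult.assoc)
    also have "\<dots> = (\<Sum>i\<in>(UNIV :: 'a set). \<Sum>j\<in>(UNIV :: 'a set). 0)"
      by (intro sum.cong refl) (simp add: wedge_component algebra_simps)
    finally show ?thesis by (simp add: curvature_tensor_def inner_biv_def)
  qed
  ultimately show ?thesis by (simp add: algebraic_curvature_operator_def)
qed

lemma self_adjoint_hadamard:
  assumes "\<And>i j. \<kappa> i j = \<kappa> j i"
  shows "self_adjoint_biv (hadamard \<kappa>)"
  using algebraic_curvature_operator_hadamard [of \<kappa>] assms
  by (simp add: algebraic_curvature_operator_def)

lemma curvature_tensor_hadamard:
  assumes sym: "\<And>i j. \<kappa> i j = \<kappa> j i"
  shows "curvature_tensor (hadamard \<kappa>) (axis a 1) (axis b 1) (axis c 1) (axis d 1)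
    = \<kappa> a b * ((if a = c then 1 else 0) * (if b = d then 1 else 0) - (if a = d then 1 else 0) * (if b = c then 1 else 0))"
proof -
  have "hadamard \<kappa> (wedge (axis a 1) (axis b 1)) = \<kappa> a b *\<^sub>R wedge (axis a 1) (axis b 1)"
    by (auto simp: hadamard_def vec_eq_iff wedge_component axis_def sym)
  then show ?thesis
    by (simp add: curvature_tensor_def inner_biv_def inner_biv_wedge [unfolded inner_biv_def, simplified]
       inner_axis_axis)
qed

text \<open>
If \<open>R \<ge> 1 - k B \<otimes> B\<close>, then the sum of the values of \<open>R\<close> on an orthonormal family, taken with weights
between \<open>0\<close> and \<open>1\<close> of total \<open>k\<close>, is at least \<open>k - k |B|\<^sup>2 = 0\<close>, by Bessel's inequality.
\<close>

lemma k_nonnegative_rank_one_perturbation: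
  fixes R :: "real ^ 'n ^ 'n \<Rightarrow> real ^ 'n ^ 'n"
  assumes R: "self_adjoint_biv R" and B: "B \<in> bivectors" "inner_biv B B = 1"
    and k: "0 \<le> k" "nat \<lfloor>k\<rfloor> + 1 \<le> CARD('n) choose 2"
    and ge: "\<And>A. A \<in> bivectors \<Longrightarrow> inner_biv A A - k * (inner_biv B A)\<^sup>2 \<le> inner_biv (R A) A"
  shows "k_nonnegative k R"
proof -
  define N where "N = CARD('n) choose 2"
  define m where "m = nat \<lfloor>k\<rfloor>"
  have m: "m + 1 \<le> N" "real m \<le> k" "k < real m + 1" "real_of_int \<lfloor>k\<rfloor> = real m"
    using k by (auto simp: m_def N_def of_nat_nat)
  note o = ordered_eigenbasis_eigensystem [OF R]
  define c where "c = (\<lambda>i. (inner_biv B (eigvec R i))\<^sup>2)"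
  have low: "1 - k * c i \<le> eigval R i" if "i \<in> {1..N}" for i
  proof -
    have "eigvec R i \<in> bivectors" "R (eigvec R i) = eigval R i *\<^sub>R eigvec R i"
        "inner_biv (eigvec R i) (eigvec R i) = 1"
      using o that by (auto simp: ordered_eigenbasis_def N_def)
    then show ?thesis using ge [of "eigvec R i"] by (simp add: c_def inner_biv_def)
  qed
  have "(\<Sum>i = 1..m. c i) + (k - m) * c (m + 1) \<le> (\<Sum>i = 1..m. c i) + 1 * c (m + 1)"
    using m by (intro add_left_mono mult_right_mono) (auto simp: c_def)
  also have "\<dots> = (\<Sum>i = 1..m + 1. c i)" by simp
  also have "\<dots> \<le> (\<Sum>i = 1..N. c i)" using m by (intro sum_mono2) (auto simp: c_def)
  also have "\<dots> = 1" using eigenbasis_quadratic(2) [OF R o B(1)] B(2) by (simp add: c_def N_def)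
  finally have "k * ((\<Sum>i = 1..m. c i) + (k - m) * c (m + 1)) \<le> k * 1"
    using k(1) by (rule mult_left_mono)
  moreover have "(\<Sum>i = 1..m. 1 - k * c i) \<le> (\<Sum>i = 1..m. eigval R i)"
    using m by (intro sum_mono low) auto
  moreover have "(k - m) * (1 - k * c (m + 1)) \<le> (k - m) * eigval R (m + 1)"
    using m by (intro mult_left_mono low) auto
  ultimately have "0 \<le> (\<Sum>i = 1..m. eigval R i) + (k - m) * eigval R (m + 1)"
    by (simp add: sum_subtractf sum_distrib_left [symmetric] algebra_simps)
  then show ?thesis
    using m(4) by (simp add: k_nonnegative_def eigval_sum_def m_def [symmetric])
qed

lemma k_nonnegative_hadamard:
  fixes \<kappa> :: "'n::finite \<Rightarrow> 'n \<Rightarrow> real"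
  assumes sym: "\<And>i j. \<kappa> i j = \<kappa> j i" and i: "i1 \<noteq> i2"
    and k: "0 \<le> k" "nat \<lfloor>k\<rfloor> + 1 \<le> CARD('n) choose 2"
    and one: "\<kappa> i1 i2 \<ge> 1 - k" and ge: "\<And>i j. i \<noteq> j \<Longrightarrow> {i, j} \<noteq> {i1, i2} \<Longrightarrow> 1 \<le> \<kappa> i j"
  shows "k_nonnegative k (hadamard \<kappa>)"
proof (rule k_nonnegative_rank_one_perturbation [where B = "wedge (axis i1 1) (axis i2 1)"])
  show "self_adjoint_biv (hadamard \<kappa>)"
    by (rule self_adjoint_hadamard) (rule sym)
  show "inner_biv (wedge (axis i1 1) (axis i2 1)) (wedge (axis i1 1) (axis i2 1)) = 1"
    using i by (simp add: inner_biv_wedge inner_axis_axis)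
  fix A :: "real ^ 'n ^ 'n" assume A: "A \<in> bivectors"
  then have skew: "A $ i $ j = - A $ j $ i" for i j using bivectors_iff by blast
  have diag: "A $ i $ i = 0" for i using skew [of i i] by simp
  have comp: "inner_biv (wedge (axis i1 1) (axis i2 1)) A = A $ i2 $ i1"
    by (simp add: inner_biv_commute [of _ A] inner_biv_wedge_right [OF A] inner_axis
        matrix_vector_mult_basis column_def)
  define p where "p = (\<lambda>i j. if i = i1 \<and> j = i2 \<or> i = i2 \<and> j = i1 then 1 else 0 :: real)"
  have "(\<Sum>i\<in>UNIV. \<Sum>j\<in>UNIV. (1 - k * p i j) * (A $ i $ j)\<^sup>2) \<le> (\<Sum>i\<in>UNIV. \<Sum>j\<in>UNIV. \<kappa> i j * (A $ i $ j)\<^sup>2)"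
  proof (intro sum_mono)
    fix i j
    show "(1 - k * p i j) * (A $ i $ j)\<^sup>2 \<le> \<kappa> i j * (A $ i $ j)\<^sup>2"
    proof (cases "i = j")
      case True
      then show ?thesis by (simp add: diag)
    next
      case False
      have "1 - k * p i j \<le> \<kappa> i j"
        using one ge [OF False] sym [of i j] by (auto simp: p_def doubleton_eq_iff)
      then show ?thesis by (intro mult_right_mono) auto
    qed
  qed
  also have "\<dots> = 2 * inner_biv (hadamard \<kappa> A) A"
    by (simp add: inner_biv_def inner_vec_def hadamard_def power2_eq_square mult_ac)
  also have "(\<Sum>i\<in>UNIV. \<Sum>j\<in>UNIV. (1 - k * p i j) * (A $ i $ j)\<^sup>2)
      = 2 * inner_biv A A - k * (\<Sum>i\<in>UNIV. \<Sum>j\<in>UNIV. p i j * (A $ i $ j)\<^sup>2)"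
  proof -
    have "2 * inner_biv A A = (\<Sum>i\<in>UNIV. \<Sum>j\<in>UNIV. (A $ i $ j)\<^sup>2)"
      by (simp add: inner_biv_def inner_vec_def power2_eq_square)
    then show ?thesis
      by (simp only: left_diff_distrib sum_subtractf sum_distrib_left mult.assoc mult_1)
  qed
  also have "(\<Sum>i\<in>UNIV. \<Sum>j\<in>UNIV. p i j * (A $ i $ j)\<^sup>2) = 2 * (A $ i2 $ i1)\<^sup>2"
  proof -
    have "(\<Sum>i\<in>UNIV. \<Sum>j\<in>UNIV. p i j * (A $ i $ j)\<^sup>2)
       = (\<Sum>i\<in>UNIV. (if i = i1 then (A $ i1 $ i2)\<^sup>2 else 0) + (if i = i2 then (A $ i2 $ i1)\<^sup>2 else 0))"
    proof (intro sum.cong refl)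
      fix i
      have "(\<Sum>j\<in>UNIV. p i j * (A $ i $ j)\<^sup>2)
        = (\<Sum>j\<in>UNIV. (if j = i2 then if i = i1 then (A $ i $ i2)\<^sup>2 else 0 else 0)
             + (if j = i1 then if i = i2 then (A $ i $ i1)\<^sup>2 else 0 else 0))"
        using i by (intro sum.cong refl) (auto simp: p_def)
      then show "(\<Sum>j\<in>UNIV. p i j * (A $ i $ j)\<^sup>2)
         = (if i = i1 then (A $ i1 $ i2)\<^sup>2 else 0) + (if i = i2 then (A $ i2 $ i1)\<^sup>2 else 0)"
        by (simp add: sum.distrib)
    qed
    then show ?thesis by (simp add: sum.distrib skew [of i1 i2])
  qed
  finally show "inner_biv A A - k * (inner_biv (wedge (axis i1 1) (axis i2 1)) A)\<^sup>2
      \<le> inner_biv (hadamard \<kappa> A) A"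
    unfolding comp by simp
qed (use k in auto)

lemma Q_hadamard:
  fixes \<kappa> :: "'n::finite \<Rightarrow> 'n \<Rightarrow> real"
  assumes sym: "\<And>i j. \<kappa> i j = \<kappa> j i" and h: "bilinear h"
    and \<mu>: "\<And>a b. h (axis a 1) (axis b 1) = (if a = b then \<mu> a else 0)"
  shows "Q (hadamard \<kappa>) h = (\<Sum>a\<in>UNIV. \<Sum>b\<in>UNIV. \<kappa> a b * (\<mu> a - \<mu> b)\<^sup>2)"
proof -
  have R: "self_adjoint_biv (hadamard \<kappa>)"
    by (rule self_adjoint_hadamard) (rule sym)
  have "Q (hadamard \<kappa>) h = (\<Sum>a\<in>UNIV. \<Sum>b\<in>-{a}. \<kappa> a b * (\<mu> a - \<mu> b)\<^sup>2)"
    unfolding Q_frame [OF R frame_axis h \<mu>]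
    by (intro sum.cong refl) (auto simp: curvature_tensor_hadamard [of \<kappa>, OF sym])
  also have "\<dots> = (\<Sum>a\<in>UNIV. \<Sum>b\<in>UNIV. \<kappa> a b * (\<mu> a - \<mu> b)\<^sup>2)"
    by (intro sum.cong refl sum.mono_neutral_left) auto
  finally show ?thesis .
qed

lemma Ric_hadamard:
  fixes \<kappa> :: "'n::finite \<Rightarrow> 'n \<Rightarrow> real"
  assumes sym: "\<And>i j. \<kappa> i j = \<kappa> j i"
  shows "Ric (hadamard \<kappa>) (axis a 1) (axis b 1) = (if a = b then (\<Sum>c\<in>-{a}. \<kappa> a c) else 0)"
proof -
  have R: "self_adjoint_biv (hadamard \<kappa>)"
    by (rule self_adjoint_hadamard) (rule sym)
  have "(\<Sum>c\<in>UNIV. \<kappa> a c * ((if a = b then 1 else 0) * 1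
      - (if a = c then 1 else 0) * (if c = b then 1 else 0))) = (if a = b then (\<Sum>c\<in>-{a}. \<kappa> a c) else 0)"
  proof (cases "a = b")
    case True
    have "(\<Sum>c\<in>UNIV. \<kappa> a c * (1 - (if a = c then 1 else 0) * (if c = a then 1 else 0))) = (\<Sum>c\<in>-{a}. \<kappa> a c)"
      by (intro sum.mono_neutral_cong_right) auto
    then show ?thesis using True by simp
  next
    case False
    then show ?thesis by (auto intro!: sum.neutral)
  qed
  then show ?thesis
    by (simp add: Ric_frame [OF R frame_axis] curvature_tensor_hadamard [of \<kappa>, OF sym])
qed


section \<open>The counterexamples\<close>

lemma Q_negative_example:
  assumes n: "5 \<le> CARD('n)"
  shows "\<exists>(R :: real ^ 'n ^ 'n \<Rightarrow> real ^ 'n ^ 'n) h. algebraic_curvature_operator R \<and>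
     k_nonnegative (2 * (real CARD('n) - 1) / 3) R \<and> symmetric_two_tensor h \<and> trace_free h \<and> Q R h < 0"
proof -
  define k where "k = 2 * (real CARD('n) - 1) / 3"
  have k: "1 \<le> k" "nat \<lfloor>k\<rfloor> + 1 \<le> CARD('n) choose 2"
    using floor_index_le [of "CARD('n)" k] n by (auto simp: k_def)
  have "2 \<le> card (UNIV :: 'n set)" using n by simp
  then obtain S :: "'n set" where "card S = 2" using obtain_subset_with_card_n by blast
  then obtain i1 i2 :: 'n where i: "i1 \<noteq> i2" by (auto simp: card_2_iff)
  define p where "p = (\<lambda>i j :: 'n. (if i = i1 then if j = i2 then 1 else 0 else 0) + (if i = i2 then if j = i1 then 1 else 0 else 0) :: real)"
  define \<kappa> where "\<kappa> = (\<lambda>i j. 1 - k * p i j)"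
  define h where "h = (\<lambda>x y :: real ^ 'n. x $ i1 * y $ i1 - x $ i2 * y $ i2)"
  define \<mu> where "\<mu> = (\<lambda>a. if a = i1 then 1 else if a = i2 then - 1 else 0 :: real)"
  have sym: "\<kappa> a b = \<kappa> b a" for a b by (auto simp: \<kappa>_def p_def)
  have h: "bilinear h" by (auto simp: bilinear_def linear_iff h_def algebra_simps)
  have h\<mu>: "h (axis a 1) (axis b 1) = (if a = b then \<mu> a else 0)" for a b
    using i by (auto simp: h_def \<mu>_def axis_def)
  have m1: "(\<Sum>a\<in>UNIV. f a * \<mu> a) = f i1 - f i2" for f
  proof -
    have "f a * \<mu> a = (if a = i1 then f i1 else 0) - (if a = i2 then f i2 else 0)" for a
      using i by (auto simp: \<mu>_def)
    then show ?thesis by (simp add: sum_subtractf)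
  qed
  have "symmetric_two_tensor h" using h by (simp add: symmetric_two_tensor_def h_def mult.commute)
  moreover have "trace_free h"
    unfolding trace_free_def frame_trace [OF frame_axis h] using m1 [of "\<lambda>_. 1"] by (simp add: h\<mu>)
  moreover have "k_nonnegative k (hadamard \<kappa>)"
    using i k by (intro k_nonnegative_hadamard [OF sym i]) (auto simp: \<kappa>_def p_def doubleton_eq_iff)
  moreover have "Q (hadamard \<kappa>) h < 0"
  proof -
    have "Q (hadamard \<kappa>) h = (\<Sum>a\<in>UNIV. \<Sum>b\<in>UNIV. (\<mu> a - \<mu> b)\<^sup>2) - k * (\<Sum>a\<in>UNIV. \<Sum>b\<in>UNIV. p a b * (\<mu> a - \<mu> b)\<^sup>2)"
      unfolding Q_hadamard [OF sym h h\<mu>]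
      by (simp only: \<kappa>_def left_diff_distrib sum_subtractf sum_distrib_left mult.assoc mult_1)
    also have "(\<Sum>a\<in>UNIV. \<Sum>b\<in>UNIV. (\<mu> a - \<mu> b)\<^sup>2) = 2 * spread \<mu>"
      by (simp add: spread_def)
    also have "spread \<mu> = 2 * CARD('n)"
      using m1 [of \<mu>] m1 [of "\<lambda>_. 1"] i by (simp add: spread_eq power2_eq_square) (simp add: \<mu>_def)
    also have "(\<Sum>a\<in>UNIV. \<Sum>b\<in>UNIV. p a b * (\<mu> a - \<mu> b)\<^sup>2) = 8"
    proof -
      have "(\<Sum>b\<in>UNIV. p a b * (\<mu> a - \<mu> b)\<^sup>2) = (if a = i1 then 4 else 0) + (if a = i2 then 4 else 0)" for a
      proof -
        have "p a b * (\<mu> a - \<mu> b)\<^sup>2 = (if b = i2 then if a = i1 then 4 else 0 else 0)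
            + (if b = i1 then if a = i2 then 4 else 0 else 0)" for b
          using i by (auto simp: p_def \<mu>_def)
        then show ?thesis by (simp add: sum.distrib)
      qed
      then show ?thesis by (simp add: sum.distrib)
    qed
    finally show ?thesis using n by (simp add: k_def)
  qed
  moreover have "algebraic_curvature_operator (hadamard \<kappa>)"
    by (rule algebraic_curvature_operator_hadamard) (rule sym)
  ultimately show ?thesis unfolding k_def by blast
qed

text \<open>
The data are integral multiples of \<open>u\<close> near the equality case of the estimates, with
\<open>\<rho> = 1 / 14\<close> and \<open>m = 11 / 38\<close>: the Ricci eigenvalues, less \<open>n - 1\<close>, are \<open>96 u\<close>, \<open>- 170 u\<close>,
\<open>19 u\<close> on the 14 indices in \<open>L\<close> and \<open>12 u\<close> on the remaining \<open>n - 16\<close> indices in \<open>H\<close>. The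
positive constant \<open>c\<close> on \<open>H\<close> serves to keep these last eigenvalues close to those on \<open>L\<close>. With
these numbers \<open>Q = 2 u\<^sup>2 (40866 n - 10451406 u)\<close>, which changes sign between 341 and 342.
\<close>

lemma Q_Ric_negative_example:
  assumes n: "342 \<le> CARD('n)"
  shows "\<exists>R :: real ^ 'n ^ 'n \<Rightarrow> real ^ 'n ^ 'n. algebraic_curvature_operator R \<and>
     k_nonnegative (2 * (real CARD('n) - 1) / 3) R \<and> Q R (Ric R) < 0"
proof -
  define N where "N = real CARD('n)"
  have N: "N \<ge> 342" using n by (simp add: N_def)
  define u where "u = (N - 1) / 255"
  have u: "u > 0" using N by (simp add: u_def)
  define k where "k = 170 * u"
  have k_eq: "k = 2 * (real CARD('n) - 1) / 3" by (simp add: k_def u_def N_def)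
  have k: "1 \<le> k" "nat \<lfloor>k\<rfloor> + 1 \<le> CARD('n) choose 2"
    using floor_index_le [OF _ k_eq] n by auto
  have "16 \<le> card (UNIV :: 'n set)" using n by simp
  then obtain S :: "'n set" where S: "card S = 16" using obtain_subset_with_card_n by blast
  obtain i1 where i1: "i1 \<in> S" using S by fastforce
  have S1: "card (S - {i1}) = 15" using S i1 by simp
  then have "S - {i1} \<noteq> {}" by (metis card.empty zero_neq_numeral)
  then obtain i2 where i2: "i2 \<in> S - {i1}" by blast
  define L where "L = S - {i1} - {i2}"
  define H where "H = - S"
  have cL: "real (card L) = 14" using S1 i2 by (simp add: L_def)
  have cH: "real (card H) = N - 16"
    using S n by (simp add: H_def Compl_eq_Diff_UNIV card_Diff_subset N_def of_nat_diff)
  have i: "i1 \<noteq> i2" using i2 by auto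
  have split: "(\<Sum>a\<in>UNIV. f a) = f i1 + f i2 + (\<Sum>a\<in>L. f a) + (\<Sum>a\<in>H. f a)" for f :: "'n \<Rightarrow> real"
  proof -
    have "(\<Sum>a\<in>UNIV. f a) = (\<Sum>a\<in>S. f a) + (\<Sum>a\<in>H. f a)"
      unfolding H_def by (subst sum.subset_diff [of S]) (auto simp: Compl_eq_Diff_UNIV add.commute)
    also have "(\<Sum>a\<in>S. f a) = f i1 + (f i2 + (\<Sum>a\<in>L. f a))"
      using i1 i2 by (simp add: L_def sum.remove [of S i1] sum.remove [of "S - {i1}" i2])
    finally show ?thesis by simp
  qed
  have disj: "i1 \<notin> L" "i2 \<notin> L" "i1 \<notin> H" "i2 \<notin> H" "\<And>a. a \<in> L \<Longrightarrow> a \<notin> H" "\<And>a. a \<in> H \<Longrightarrow> a \<notin> L"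
    "\<And>a. a \<in> L \<Longrightarrow> a \<noteq> i1" "\<And>a. a \<in> L \<Longrightarrow> a \<noteq> i2" "\<And>a. a \<in> H \<Longrightarrow> a \<noteq> i1" "\<And>a. a \<in> H \<Longrightarrow> a \<noteq> i2"
    using i1 i2 by (auto simp: L_def H_def)
  define g where "g = 19 * u"
  define c where "c = 12 * u / (N - 17)"
  have c: "c * (N - 17) = 12 * u" "c \<ge> 0" using N u by (auto simp: c_def)
  define \<kappa> where "\<kappa> = (\<lambda>a b. if a = i1 \<and> b = i2 \<or> a = i2 \<and> b = i1 then 1 - k
     else if a = i1 \<and> b \<in> L \<or> a \<in> L \<and> b = i1 then 1 + g
     else if a \<in> H \<and> b \<in> H then 1 + c else 1)"
  have sym: "\<kappa> a b = \<kappa> b a" for a b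
    unfolding \<kappa>_def by (intro if_cong refl) auto
  define \<mu> where "\<mu> = (\<lambda>a. \<Sum>b\<in>-{a}. \<kappa> a b)"
  have \<mu>_eq: "\<mu> a = \<kappa> a i1 + \<kappa> a i2 + (\<Sum>b\<in>L. \<kappa> a b) + (\<Sum>b\<in>H. \<kappa> a b) - \<kappa> a a" for a
    by (simp add: \<mu>_def Compl_eq_Diff_UNIV sum_diff1 split)
  have k1: "\<kappa> i1 i2 = 1 - k" "\<kappa> i2 i1 = 1 - k" "\<kappa> i1 i1 = 1" "\<kappa> i2 i2 = 1" using i by (simp_all add: \<kappa>_def disj)
  have kL: "\<kappa> i1 a = 1 + g" "\<kappa> a i1 = 1 + g" "\<kappa> i2 a = 1" "\<kappa> a i2 = 1" if "a \<in> L" for a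
    using that i by (simp_all add: \<kappa>_def disj)
  have kH: "\<kappa> i1 a = 1" "\<kappa> a i1 = 1" "\<kappa> i2 a = 1" "\<kappa> a i2 = 1" if "a \<in> H" for a
    using that i by (simp_all add: \<kappa>_def disj)
  have kLL: "\<kappa> a b = 1" if "a \<in> L" "b \<in> L" for a b using that i by (simp_all add: \<kappa>_def disj)
  have kLH: "\<kappa> a b = 1" "\<kappa> b a = 1" if "a \<in> L" "b \<in> H" for a b using that i by (simp_all add: \<kappa>_def disj)
  have kHH: "\<kappa> a b = 1 + c" if "a \<in> H" "b \<in> H" for a b using that i by (simp_all add: \<kappa>_def disj)
  note ks = k1 kL kH kLL kLH kHH
  have m1: "\<mu> i1 = N - 1 + 96 * u"
    by (simp add: \<mu>_eq ks cL cH k_def g_def algebra_simps)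
  have m2: "\<mu> i2 = N - 1 - 170 * u"
    by (simp add: \<mu>_eq ks cL cH k_def g_def algebra_simps)
  have mL: "\<mu> a = N - 1 + 19 * u" if "a \<in> L" for a
    using that by (simp add: \<mu>_eq ks cL cH k_def g_def algebra_simps)
  have mH: "\<mu> a = N - 1 + 12 * u" if "a \<in> H" for a
    using that c(1) by (simp add: \<mu>_eq ks cL cH k_def g_def algebra_simps)
  note ms = m1 m2 mL mH
  have R: "self_adjoint_biv (hadamard \<kappa>)" by (rule self_adjoint_hadamard) (rule sym)
  have bil: "bilinear (Ric (hadamard \<kappa>))"
    using symmetric_two_tensor_Ric [OF R] by (simp add: symmetric_two_tensor_def)
  have ric: "Ric (hadamard \<kappa>) (axis a 1) (axis b 1) = (if a = b then \<mu> a else 0)" for a b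
    unfolding \<mu>_def by (rule Ric_hadamard) (rule sym)
  have "Q (hadamard \<kappa>) (Ric (hadamard \<kappa>)) = (\<Sum>a\<in>UNIV. \<Sum>b\<in>UNIV. \<kappa> a b * (\<mu> a - \<mu> b)\<^sup>2)"
    by (rule Q_hadamard [OF sym bil ric])
  also have "\<dots> = 2 * u\<^sup>2 * (40866 * N - 10451406 * u)"
    by (simp add: split ks ms cL cH k_def g_def power2_eq_square algebra_simps)
  also have "\<dots> < 0"
  proof -
    have "40866 * N - 10451406 * u < 0" using N by (simp add: u_def field_simps)
    then show ?thesis using u by (intro mult_pos_neg) auto
  qed
  finally have "Q (hadamard \<kappa>) (Ric (hadamard \<kappa>)) < 0" .
  moreover have "k_nonnegative k (hadamard \<kappa>)"
    using i k u c(2) k1 by (intro k_nonnegative_hadamard [OF sym i]) (auto simp: \<kappa>_def g_def)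
  moreover have "algebraic_curvature_operator (hadamard \<kappa>)"
    by (rule algebraic_curvature_operator_hadamard) (rule sym)
  ultimately show ?thesis unfolding k_eq by blast
qed


theorem theoremA1:
  shows
    "(5 \<le> CARD('n::finite) \<longrightarrow>
        (\<exists>(R :: real ^ 'n ^ 'n \<Rightarrow> real ^ 'n ^ 'n) (h :: real ^ 'n \<Rightarrow> real ^ 'n \<Rightarrow> real).
           algebraic_curvature_operator R \<and>
           k_nonnegative (2 * (real CARD('n) - 1) / 3) R \<and>
           symmetric_two_tensor h \<and> trace_free h \<and> Q R h < 0)) \<and>
     (3 \<le> CARD('n) \<and> CARD('n) \<le> 341 \<longrightarrow>
        (\<forall>R :: real ^ 'n ^ 'n \<Rightarrow> real ^ 'n ^ 'n.
           algebraic_curvature_operator R \<and>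
           k_nonnegative (2 * (real CARD('n) - 1) / 3) R \<longrightarrow>
           0 \<le> Q R (Ric R))) \<and>
     (342 \<le> CARD('n) \<longrightarrow>
        (\<exists>R :: real ^ 'n ^ 'n \<Rightarrow> real ^ 'n ^ 'n.
           algebraic_curvature_operator R \<and>
           k_nonnegative (2 * (real CARD('n) - 1) / 3) R \<and>
           Q R (Ric R) < 0))"
proof (intro conjI impI allI)
  assume "5 \<le> CARD('n)"
  then show "\<exists>(R :: real ^ 'n ^ 'n \<Rightarrow> real ^ 'n ^ 'n) h. algebraic_curvature_operator R \<and>
      k_nonnegative (2 * (real CARD('n) - 1) / 3) R \<and>
      symmetric_two_tensor h \<and> trace_free h \<and> Q R h < 0"
    by (rule Q_negative_example)
next
  fix R :: "real ^ 'n ^ 'n \<Rightarrow> real ^ 'n ^ 'n"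
  assume "3 \<le> CARD('n) \<and> CARD('n) \<le> 341"
    and "algebraic_curvature_operator R \<and> k_nonnegative (2 * (real CARD('n) - 1) / 3) R"
  then show "0 \<le> Q R (Ric R)"
    by (intro Q_Ric_nonneg) (auto simp: algebraic_curvature_operator_def)
next
  assume "342 \<le> CARD('n)"
  then show "\<exists>R :: real ^ 'n ^ 'n \<Rightarrow> real ^ 'n ^ 'n. algebraic_curvature_operator R \<and>
      k_nonnegative (2 * (real CARD('n) - 1) / 3) R \<and> Q R (Ric R) < 0"
    by (rule Q_Ric_negative_example)
qed

end
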